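(* Let $2\le n<\infty$, $m\ge 1$, let $z\in(\mathcal{V}_{n,m})_1$ and let $\omega$ be a sub-Cuntz state on $\mathcal{O}_n$ by $z$. (i) (Uniqueness) $\omega$ is unique (i.e. it is the only sub-Cuntz state on $\mathcal{O}_n$ by $z$) if and only if $z$ is nonperiodic. In this case, write $\tilde{\omega}_z$ for $\omega$. (ii) If $z$ is nonperiodic, then $\tilde{\omega}_z$ is pure. (iii) If $z$ is nonperiodic, then for all words $J,K\in\bigcup_{a\ge 1}\{1,\ldots,n\}^a\cup\{\emptyset\}$, $$\tilde{\omega}_z(s_Js_K^* )=\begin{cases}\overline{z_J}\,z_K & \text{when } |J|,|K|\in m\mathbb{Z}_{\ge 0},\\[1mm] 0 & \text{when } |J|-|K|\notin m\mathbb{Z},\\[1mm] \overline{z_{J_1}}\,z_{K_1}\displaystyle\sum_{|L|=m-|J_2|}\overline{z_{J_2L}}\,z_{K_2L} & \text{otherwise,}\end{cases}$$ where in the "otherwise" case $J=J_1J_2$ and $K=K_1K_2$ with $|J_1|,|K_1|\in m\mathbb{Z}_{\ge 0}$ and $1\le |J_2|=|K_2|\le m-1$.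
   Context: $\mathcal{O}_n$ ($2\le n<\infty$) is the Cuntz algebra, the universal C$^*$-algebra generated by $s_1,\ldots,s_n$ with $s_i^*s_j=\delta_{ij}I$ and $\sum_{i=1}^n s_is_i^*=I$. For a word $J=(j_1,\ldots,j_k)\in\{1,\ldots,n\}^k$, put $|J|=k$ and $s_J:=s_{j_1}\cdots s_{j_k}$; $s_\emptyset:=I$, $|\emptyset|=0$; $JK$ denotes concatenation. $\mathcal{V}_{n,m}:=\ell^2(\{1,\ldots,n\}^m)$ is the Hilbert space with orthonormal basis $\{e_J: J\in\{1,\ldots,n\}^m\}$, identified with $(\mathbb{C}^n)^{\otimes m}$ via $e_J\leftrightarrow e_{j_1}\otimes\cdots\otimes e_{j_m}$, so that $\mathcal{V}_{n,m}\otimes\mathcal{V}_{n,l}=\mathcal{V}_{n,m+l}$. $(\mathcal{V}_{n,m})_1$ is the set of unit vectors. For $z=\sum z_Je_J\in(\mathcal{V}_{n,m})_1$, a sub-Cuntz state on $\mathcal{O}_n$ by $z$ is a state $\omega$ on $\mathcal{O}_n$ with $\omega(s_J)=\overline{z_J}$ for all $J\in\{1,\ldots,n\}^m$. (Such a state exists for every $z$.) $z$ is nonperiodic if $z=x^{\otimes p}$ for some $p\ge 1$ and some $x\in\bigcup_{k\ge1}\mathcal{V}_{n,k}$ implies $p=1$. For words of length a multiple of $m$: $z_\emptyset:=1$, and $z_J:=z_{J^{(1)}}\cdots z_{J^{(l)}}$ when $J=J^{(1)}\cdots J^{(l)}$ with $|J^{(i)}|=m$ for all $i$. The sum over $|L|=m-|J_2|$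 runs over words $L\in\{1,\ldots,n\}^{m-|J_2|}$. *)

theory Defs
  imports "HOL-Analysis.Analysis" "HOL-Algebra.Ring"
begin

section \<open>Unital C*-algebras\<close>

text \<open>
  A unital nonzero C*-algebra occupying a whole type. The complex scalar multiplication extends the
  real one of the Banach algebra.
\<close>

class cstar_algebra = real_normed_algebra_1 + banach +
  fixes scaleC :: "complex \<Rightarrow> 'a \<Rightarrow> 'a"
    and star :: "'a \<Rightarrow> 'a"
  assumes scaleC_of_real: "scaleC (complex_of_real r) x = r *\<^sub>R x"
    and scaleC_scaleC: "scaleC c (scaleC d x) = scaleC (c * d) x"
    and scaleC_add_left: "scaleC (c + d) x = scaleC c x + scaleC d x"
    and scaleC_add_right: "scaleC c (x + y) = scaleC c x + scaleC c y"
    and mult_scaleC_left: "scaleC c x * y = scaleC c (x * y)"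
    and mult_scaleC_right: "x * scaleC c y = scaleC c (x * y)"
    and norm_scaleC: "norm (scaleC c x) = cmod c * norm x"
    and star_star: "star (star x) = x"
    and star_add: "star (x + y) = star x + star y"
    and star_scaleC: "star (scaleC c x) = scaleC (cnj c) (star x)"
    and star_mult: "star (x * y) = star y * star x"
    and cstar_identity: "norm (star x * x) = (norm x)\<^sup>2"

text \<open>
  The universal property of the Cuntz algebra quantifies over all unital C*-algebras, which types
  of class \<open>cstar_algebra\<close> cannot express inside a formula. Its targets are therefore given as
  structures with an explicit carrier; the zero algebra is allowed among them.
\<close>

record 'b cstar_struct = "'b ring" +
  smul :: "complex \<Rightarrow> 'b \<Rightarrow> 'b"
  adj :: "'b \<Rightarrow> 'b"
  nrm :: "'b \<Rightarrow> real"

locale cstar_structure = ring B for B :: "'b cstar_struct" (structure) +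
  assumes smul_closed: "x \<in> carrier B \<Longrightarrow> smul B c x \<in> carrier B"
    and smul_one: "x \<in> carrier B \<Longrightarrow> smul B 1 x = x"
    and smul_smul: "x \<in> carrier B \<Longrightarrow> smul B c (smul B d x) = smul B (c * d) x"
    and smul_add_left: "x \<in> carrier B \<Longrightarrow> smul B (c + d) x = smul B c x \<oplus> smul B d x"
    and smul_add_right:
      "\<lbrakk>x \<in> carrier B; y \<in> carrier B\<rbrakk> \<Longrightarrow> smul B c (x \<oplus> y) = smul B c x \<oplus> smul B c y"
    and mult_smul_left:
      "\<lbrakk>x \<in> carrier B; y \<in> carrier B\<rbrakk> \<Longrightarrow> smul B c x \<otimes> y = smul B c (x \<otimes> y)"
    and mult_smul_right:
      "\<lbrakk>x \<in> carrier B; y \<in> carrier B\<rbrakk> \<Longrightarrow> x \<otimes> smul B c y = smul B c (x \<otimes> y)"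
    and adj_closed: "x \<in> carrier B \<Longrightarrow> adj B x \<in> carrier B"
    and adj_adj: "x \<in> carrier B \<Longrightarrow> adj B (adj B x) = x"
    and adj_add: "\<lbrakk>x \<in> carrier B; y \<in> carrier B\<rbrakk> \<Longrightarrow> adj B (x \<oplus> y) = adj B x \<oplus> adj B y"
    and adj_smul: "x \<in> carrier B \<Longrightarrow> adj B (smul B c x) = smul B (cnj c) (adj B x)"
    and adj_mult: "\<lbrakk>x \<in> carrier B; y \<in> carrier B\<rbrakk> \<Longrightarrow> adj B (x \<otimes> y) = adj B y \<otimes> adj B x"
    and nrm_nonneg: "x \<in> carrier B \<Longrightarrow> 0 \<le> nrm B x"
    and nrm_eq_0: "x \<in> carrier B \<Longrightarrow> nrm B x = 0 \<longleftrightarrow> x = \<zero>"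
    and nrm_triangle:
      "\<lbrakk>x \<in> carrier B; y \<in> carrier B\<rbrakk> \<Longrightarrow> nrm B (x \<oplus> y) \<le> nrm B x + nrm B y"
    and nrm_smul: "x \<in> carrier B \<Longrightarrow> nrm B (smul B c x) = cmod c * nrm B x"
    and nrm_mult: "\<lbrakk>x \<in> carrier B; y \<in> carrier B\<rbrakk> \<Longrightarrow> nrm B (x \<otimes> y) \<le> nrm B x * nrm B y"
    and nrm_cstar: "x \<in> carrier B \<Longrightarrow> nrm B (adj B x \<otimes> x) = (nrm B x)\<^sup>2"
    and complete: "Metric_space.mcomplete (carrier B) (\<lambda>x y. nrm B (x \<ominus> y))"

text \<open>A type of class \<open>cstar_algebra\<close> is such a structure, so the two notions agree.\<close>

definition type_struct :: "'a::cstar_algebra cstar_struct" where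
  "type_struct = \<lparr>carrier = UNIV, mult = (*), one = 1, zero = 0, add = (+),
     smul = scaleC, adj = star, nrm = norm\<rparr>"

lemma type_struct_simps [simp]:
  "carrier type_struct = UNIV"
  "x \<otimes>\<^bsub>type_struct\<^esub> y = x * y" "\<one>\<^bsub>type_struct\<^esub> = 1"
  "\<zero>\<^bsub>type_struct\<^esub> = 0" "x \<oplus>\<^bsub>type_struct\<^esub> y = x + y"
  "smul type_struct = scaleC" "adj type_struct = star" "nrm type_struct = norm"
  by (simp_all add: type_struct_def)

lemma ring_type_struct: "ring (type_struct :: 'a::cstar_algebra cstar_struct)"
proof (rule ringI)
  show "abelian_group (type_struct :: 'a cstar_struct)"
    by (rule abelian_groupI) (auto simp: algebra_simps intro: exI[where x="- _"] left_minus)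
  show "monoid (type_struct :: 'a cstar_struct)"
    by (rule monoidI) (auto simp: algebra_simps)
qed (auto simp: algebra_simps)

lemma type_struct_minus [simp]: "x \<ominus>\<^bsub>type_struct\<^esub> y = x - (y :: 'a::cstar_algebra)"
proof -
  interpret R: ring "type_struct :: 'a cstar_struct" by (rule ring_type_struct)
  have "\<ominus>\<^bsub>type_struct\<^esub> y = - y"
    using R.minus_equality[of "- y" y] by simp
  then show ?thesis by (simp add: a_minus_def)
qed

lemma cstar_structure_type_struct:
  "cstar_structure (type_struct :: 'a::cstar_algebra cstar_struct)"
proof (intro cstar_structure.intro cstar_structure_axioms.intro ring_type_struct)
  have "Metric_space.mcomplete (UNIV :: 'a set) dist"
    using mcomplete_iff_complete[where 'a='a] complete_UNIV by blast
  then show "Metric_space.mcomplete (carrier (type_struct :: 'a cstar_struct))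
      (\<lambda>x y. nrm type_struct (x \<ominus>\<^bsub>type_struct\<^esub> y))"
    by (simp add: dist_norm[abs_def])
qed (auto simp: scaleC_scaleC scaleC_add_left scaleC_add_right mult_scaleC_left
    mult_scaleC_right norm_scaleC star_star star_add star_scaleC star_mult cstar_identity
    scaleC_of_real[of 1, simplified] norm_triangle_ineq norm_mult_ineq)

definition star_hom :: "'b cstar_struct \<Rightarrow> ('a::cstar_algebra \<Rightarrow> 'b) \<Rightarrow> bool" where
  "star_hom B \<phi> \<longleftrightarrow>
     range \<phi> \<subseteq> carrier B \<and>
     (\<forall>x y. \<phi> (x + y) = \<phi> x \<oplus>\<^bsub>B\<^esub> \<phi> y) \<and>
     (\<forall>c x. \<phi> (scaleC c x) = smul B c (\<phi> x)) \<and>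
     (\<forall>x y. \<phi> (x * y) = \<phi> x \<otimes>\<^bsub>B\<^esub> \<phi> y) \<and>
     (\<forall>x. \<phi> (star x) = adj B (\<phi> x)) \<and>
     \<phi> 1 = \<one>\<^bsub>B\<^esub>"

definition cstar_subalgebra :: "'a::cstar_algebra set \<Rightarrow> bool" where
  "cstar_subalgebra S \<longleftrightarrow>
     closed S \<and> 1 \<in> S \<and>
     (\<forall>x\<in>S. \<forall>y\<in>S. x + y \<in> S \<and> x * y \<in> S) \<and>
     (\<forall>c. \<forall>x\<in>S. scaleC c x \<in> S) \<and>
     (\<forall>x\<in>S. star x \<in> S)"


section \<open>Cuntz algebras\<close>

definition cuntz_family :: "'b cstar_struct \<Rightarrow> nat \<Rightarrow> (nat \<Rightarrow> 'b) \<Rightarrow> bool" where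
  "cuntz_family B n t \<longleftrightarrow>
     (\<forall>i\<in>{1..n}. t i \<in> carrier B) \<and>
     (\<forall>i\<in>{1..n}. \<forall>j\<in>{1..n}. adj B (t i) \<otimes>\<^bsub>B\<^esub> t j = (if i = j then \<one>\<^bsub>B\<^esub> else \<zero>\<^bsub>B\<^esub>)) \<and>
     (\<Oplus>\<^bsub>B\<^esub>i\<in>{1..n}. t i \<otimes>\<^bsub>B\<^esub> adj B (t i)) = \<one>\<^bsub>B\<^esub>"

lemma cuntz_family_type_struct:
  fixes s :: "nat \<Rightarrow> 'a::cstar_algebra"
  shows "cuntz_family type_struct n s \<longleftrightarrow>
     (\<forall>i\<in>{1..n}. \<forall>j\<in>{1..n}. star (s i) * s j = (if i = j then 1 else 0)) \<and>
     (\<Sum>i=1..n. s i * star (s i)) = 1"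
proof -
  interpret R: ring "type_struct :: 'a cstar_struct" by (rule ring_type_struct)
  have "finsum type_struct f A = sum f A" if "finite A" for f :: "nat \<Rightarrow> 'a" and A
    using that by (induction A rule: finite_induct) simp_all
  then show ?thesis by (simp add: cuntz_family_def)
qed

text \<open>
  The type \<open>'a\<close> with generators \<open>s 1, \<dots>, s n\<close> is the Cuntz algebra: it is generated by a family
  satisfying the Cuntz relations and every such family in a unital C*-algebra \<open>B\<close> is the image of
  \<open>s\<close> under a *-homomorphism (necessarily unique, by generation). It is no restriction that the
  elements of \<open>B\<close> are drawn from \<open>'a\<close>: the C*-subalgebra of \<open>B\<close> generated by the family
  is separable, hence has at most the cardinality of the continuum, and \<open>'a\<close>, being a nonzero
  complex vector space, has at least that cardinality.
\<close>

definition cuntz_algebra :: "nat \<Rightarrow> (nat \<Rightarrow> 'a::cstar_algebra) \<Rightarrow> bool" where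
  "cuntz_algebra n s \<longleftrightarrow>
     cuntz_family type_struct n s \<and>
     cstar_subalgebra hull (s ` {1..n}) = UNIV \<and>
     (\<forall>(B :: 'a cstar_struct) t. cstar_structure B \<and> cuntz_family B n t \<longrightarrow>
        (\<exists>\<phi>. star_hom B \<phi> \<and> (\<forall>i\<in>{1..n}. \<phi> (s i) = t i)))"


section \<open>States\<close>

text \<open>
  On a unital C*-algebra a positive linear functional is automatically bounded, with norm
  \<open>\<omega> 1\<close>.
\<close>

definition state :: "('a::cstar_algebra \<Rightarrow> complex) \<Rightarrow> bool" where
  "state \<omega> \<longleftrightarrow>
     (\<forall>x y. \<omega> (x + y) = \<omega> x + \<omega> y) \<and>
     (\<forall>c x. \<omega> (scaleC c x) = c * \<omega> x) \<and>
     (\<forall>x. \<omega> (star x * x) \<in> \<real>\<^sub>\<ge>\<^sub>0) \<and>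
     \<omega> 1 = 1"

text \<open>Pure states are the extreme points of the convex set of states.\<close>

definition pure_state :: "('a::cstar_algebra \<Rightarrow> complex) \<Rightarrow> bool" where
  "pure_state \<omega> \<longleftrightarrow>
     state \<omega> \<and>
     (\<forall>\<omega>1 \<omega>2. \<forall>t::real. state \<omega>1 \<and> state \<omega>2 \<and> 0 < t \<and> t < 1 \<and>
        (\<forall>x. \<omega> x = of_real t * \<omega>1 x + of_real (1 - t) * \<omega>2 x) \<longrightarrow> \<omega>1 = \<omega> \<and> \<omega>2 = \<omega>)"


section \<open>Words and tensors\<close>

definition words :: "nat \<Rightarrow> nat \<Rightarrow> nat list set" where
  "words n k = {J \<in> lists {1..n}. length J = k}"

definition word_prod :: "(nat \<Rightarrow> 'a::monoid_mult) \<Rightarrow> nat list \<Rightarrow> 'a" where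
  "word_prod s J = prod_list (map s J)"

text \<open>
  A vector of \<open>\<V>\<^sub>n\<^sub>,\<^sub>k = \<ell>\<^sup>2({1,\<dots>,n}\<^sup>k)\<close> is the function of its coordinates, taken to be \<open>0\<close> off the
  words of length \<open>k\<close>, so that equality of vectors is equality of functions.
\<close>

definition tensor_space :: "nat \<Rightarrow> nat \<Rightarrow> (nat list \<Rightarrow> complex) set" where
  "tensor_space n k = {x. \<forall>J. J \<notin> words n k \<longrightarrow> x J = 0}"

definition unit_vectors :: "nat \<Rightarrow> nat \<Rightarrow> (nat list \<Rightarrow> complex) set" where
  "unit_vectors n k = {x \<in> tensor_space n k. (\<Sum>J\<in>words n k. (cmod (x J))\<^sup>2) = 1}"

text \<open>
  Under \<open>e\<^sub>J \<otimes> e\<^sub>K = e\<^sub>J\<^sub>K\<close> the coordinate of \<open>x \<otimes> y\<close> at a word \<open>JK\<close> with \<open>|J| = k\<close>, where \<open>x\<close> has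
  degree \<open>k\<close>, is \<open>x\<^sub>J y\<^sub>K\<close>.
\<close>

definition tensor :: "nat \<Rightarrow> (nat list \<Rightarrow> complex) \<Rightarrow> (nat list \<Rightarrow> complex) \<Rightarrow> nat list \<Rightarrow> complex"
  where "tensor k x y = (\<lambda>J. x (take k J) * y (drop k J))"

fun tensor_power :: "nat \<Rightarrow> (nat list \<Rightarrow> complex) \<Rightarrow> nat \<Rightarrow> nat list \<Rightarrow> complex" where
  "tensor_power k x 0 = (\<lambda>J. if J = [] then 1 else 0)"
| "tensor_power k x (Suc p) = tensor k x (tensor_power k x p)"

definition nonperiodic :: "nat \<Rightarrow> (nat list \<Rightarrow> complex) \<Rightarrow> bool" where
  "nonperiodic n z \<longleftrightarrow>
     (\<forall>p\<ge>1. \<forall>k\<ge>1. \<forall>x\<in>tensor_space n k. z = tensor_power k x p \<longrightarrow> p = 1)"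

text \<open>
  The number \<open>z\<^sub>J\<close> for a word \<open>J\<close> whose length is a multiple of \<open>m\<close>, as the product over the
  successive blocks of length \<open>m\<close>; it is meaningless for other lengths.
\<close>

definition word_coeff :: "nat \<Rightarrow> (nat list \<Rightarrow> complex) \<Rightarrow> nat list \<Rightarrow> complex" where
  "word_coeff m z J = (\<Prod>i<length J div m. z (take m (drop (i * m) J)))"

definition sub_cuntz_state ::
  "nat \<Rightarrow> nat \<Rightarrow> (nat \<Rightarrow> 'a::cstar_algebra) \<Rightarrow> (nat list \<Rightarrow> complex) \<Rightarrow> ('a \<Rightarrow> complex) \<Rightarrow> bool"
  where "sub_cuntz_state n m s z \<omega> \<longleftrightarrow>
     state \<omega> \<and> (\<forall>J\<in>words n m. \<omega> (word_prod s J) = cnj (z J))"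

end

theory Submission
  imports Defs
begin

text \<open>
  Write \<open>s(x) = \<Sum>\<^sub>J x\<^sub>J s\<^sub>J\<close> for a tensor \<open>x\<close> of degree \<open>k\<close>; it is called \<open>creation n s k x\<close> below. It is
  multiplicative, \<open>s(x \<otimes> y) = s(x) s(y)\<close>, and an isometry when \<open>x\<close> is a unit vector. A state \<open>\<omega>\<close> is
  a sub-Cuntz state by \<open>z\<close> iff \<open>\<omega>(s(z)) = 1\<close>, and by the Cauchy-Schwarz inequality this forces
  \<open>\<omega>(a s(z)) = \<omega>(a)\<close> for all \<open>a\<close>: the cyclic vector of the GNS representation is fixed by \<open>s(z)\<close>.
  Since \<open>s\<^sub>J\<^sup>* s(z) = z\<^sub>J\<close> for \<open>|J| = m\<close>, blocks of length \<open>m\<close> can be split off,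
  \<open>\<omega>(a s\<^sub>J\<^sup>*) = z\<^sub>J \<omega>(a)\<close>. Everything below is argued with such identities for \<open>\<omega>\<close>; no representation
  is constructed.

  The value \<open>\<omega>(s\<^sub>J s\<^sub>K\<^sup>*)\<close>. Inserting \<open>1 = \<Sum>\<^sub>L s\<^sub>L s\<^sub>L\<^sup>*\<close> between the factors lengthens \<open>J\<close> and \<open>K\<close>
  by the same amount. If \<open>|J| - |K|\<close> is a multiple of \<open>m\<close>, both lengths become multiples of \<open>m\<close> and the
  value is determined by \<open>z\<close>. Otherwise the value reduces to the numbers \<open>y\<^sub>K = \<omega>(s\<^sub>K\<^sup>*)\<close> with
  \<open>0 < |K| < m\<close>. The two ways of cutting a word of length \<open>|K| + m\<close> show that contracting
  \<open>z \<otimes> y\<close> with \<open>z\<close> on its last \<open>m\<close> factors gives \<open>y\<close> back. As \<open>z \<otimes> y\<close> and \<open>y\<close> have the same norm, this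
  is possible only if \<open>z \<otimes> y = y \<otimes> z\<close>. By the Euclidean algorithm, commuting nonzero tensors are
  multiples of powers of one tensor, so for nonperiodic \<open>z\<close> there is no such \<open>y \<noteq> 0\<close> of positive
  degree below \<open>m\<close> (\<open>nonperiodic_commuting_degree\<close>, \<open>sub_cuntz_short_word_zero\<close>).

  Uniqueness and purity. The monomials \<open>s\<^sub>J s\<^sub>K\<^sup>*\<close> span a dense subspace and states are bounded, so for
  nonperiodic \<open>z\<close> the state is determined. A convex decomposition of \<open>\<omega>\<close> writes \<open>\<omega>(s(z)) = 1\<close> as a
  convex combination of two numbers in the unit disc. So both are \<open>1\<close>, and both states are sub-Cuntz
  states by \<open>z\<close>; hence uniqueness implies purity.

  Uniqueness forces nonperiodicity. If \<open>\<omega>\<close> is unique, it is invariant under the gauge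
  transformations \<open>s\<^sub>i \<mapsto> c s\<^sub>i\<close> with \<open>c\<^sup>m = 1\<close>, hence vanishes on \<open>s(y)\<close> unless \<open>m\<close> divides the degree
  of \<open>y\<close>. Suppose \<open>z = x\<^sup>\<otimes>\<^sup>p\<close> with \<open>p > 1\<close> and put \<open>A = s(x)\<close>, so that \<open>A\<^sup>p = s(z)\<close>. The vectors
  \<open>\<Omega>, A\<Omega>, \<dots>, A\<^sup>p\<^sup>-\<^sup>1\<Omega>\<close> in the GNS space are orthonormal and \<open>A\<close> permutes them cyclically, so their
  normalised sum gives a state \<open>\<omega>'\<close> with \<open>\<omega>'(A) = 1\<close>. It is again a sub-Cuntz state by \<open>z\<close>, but differs
  from \<open>\<omega>\<close>, which vanishes at \<open>A\<close> (\<open>unique_sub_cuntz_state_nonperiodic\<close>).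
\<close>

section \<open>Elementary C*-algebra\<close>

lemma scaleC_one [simp]: "scaleC 1 x = (x :: 'a::cstar_algebra)"
  using scaleC_of_real[of 1 x] by simp

lemma scaleC_zero_left [simp]: "scaleC 0 x = (0 :: 'a::cstar_algebra)"
  using scaleC_of_real[of 0 x] by simp

lemma scaleC_zero_right [simp]: "scaleC c 0 = (0 :: 'a::cstar_algebra)"
  using scaleC_add_right[of c "0::'a" 0] by simp

lemma scaleC_minus_one: "scaleC (- 1) x = - (x :: 'a::cstar_algebra)"
  using scaleC_of_real[of "-1" x] by simp

lemma scaleC_sum_right:
  "scaleC c (\<Sum>i\<in>I. f i) = (\<Sum>i\<in>I. scaleC c (f i :: 'a::cstar_algebra))"
  by (induction I rule: infinite_finite_induct) (simp_all add: scaleC_add_right)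

lemma scaleC_sum_left:
  "scaleC (\<Sum>i\<in>I. f i) x = (\<Sum>i\<in>I. scaleC (f i) (x :: 'a::cstar_algebra))"
  by (induction I rule: infinite_finite_induct) (simp_all add: scaleC_add_left)

lemma star_zero [simp]: "star 0 = (0 :: 'a::cstar_algebra)"
  using star_add[of "0::'a" 0] by simp

lemma star_one [simp]: "star 1 = (1 :: 'a::cstar_algebra)"
  using star_mult[of "star 1 :: 'a" 1] by (simp add: star_star)

lemma star_minus: "star (- x) = - star (x :: 'a::cstar_algebra)"
  using star_scaleC[of "-1" x] by (simp add: scaleC_minus_one)

lemma star_diff: "star (x - y) = star x - star (y :: 'a::cstar_algebra)"
  using star_add[of x "- y"] by (simp add: star_minus)

lemma star_scaleR: "star (r *\<^sub>R x) = r *\<^sub>R star (x :: 'a::cstar_algebra)"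
  using star_scaleC[of "complex_of_real r" x] by (simp add: scaleC_of_real)

lemma star_sum: "star (\<Sum>i\<in>I. f i) = (\<Sum>i\<in>I. star (f i :: 'a::cstar_algebra))"
  by (induction I rule: infinite_finite_induct) (simp_all add: star_add)

lemma norm_star [simp]: "norm (star x) = norm (x :: 'a::cstar_algebra)"
proof -
  have le: "norm y \<le> norm (star y)" for y :: 'a
  proof (cases "y = 0")
    case False
    have "norm y * norm y \<le> norm (star y) * norm y"
      using norm_mult_ineq[of "star y" y] by (simp add: cstar_identity power2_eq_square)
    with False show ?thesis by simp
  qed simp
  show ?thesis using le[of x] le[of "star x"] by (simp add: star_star)
qed

lemma bounded_linear_star: "bounded_linear (star :: 'a::cstar_algebra \<Rightarrow> 'a)"
  by (rule bounded_linear_intro[where K=1]) (simp_all add: star_add star_scaleR)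

lemma bounded_linear_scaleC: "bounded_linear (scaleC c :: 'a::cstar_algebra \<Rightarrow> 'a)"
proof (rule bounded_linear_intro[where K="cmod c"])
  show "scaleC c (r *\<^sub>R x) = r *\<^sub>R scaleC c x" for r and x :: 'a
    by (simp add: scaleC_of_real[symmetric] scaleC_scaleC mult.commute)
qed (simp_all add: scaleC_add_right norm_scaleC mult.commute)

lemma continuous_star: "continuous_on UNIV (star :: 'a::cstar_algebra \<Rightarrow> 'a)"
  using bounded_linear_star by (rule linear_continuous_on)

text \<open>
  Writing the root as \<open>1 - y\<close>, the equation becomes \<open>y = (h + y\<^sup>2) / 2\<close>, whose right-hand side is a
  contraction of the self-adjoint part of the ball of radius \<open>1/2\<close>. This replaces functional calculus
  in the proof that states are bounded.
\<close>

lemma self_adjoint_sqrt_one_minus: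
  fixes h :: "'a::cstar_algebra"
  assumes "star h = h" and "norm h \<le> 3/4"
  shows "\<exists>k. star k = k \<and> k * k = 1 - h"
proof -
  define S where "S = {y :: 'a. star y = y} \<inter> cball 0 (1/2)"
  define f where "f y = (1/2) *\<^sub>R (h + y * y)" for y :: 'a
  have "closed {y :: 'a. star y = y}"
    by (intro closed_Collect_eq continuous_star continuous_on_id)
  then have "complete S"
    unfolding S_def by (intro closed_Int closed_cball complete_eq_closed[THEN iffD2])
  moreover have "S \<noteq> {}"
  proof -
    have "0 \<in> S" by (simp add: S_def)
    then show ?thesis by blast
  qed
  moreover have "f ` S \<subseteq> S"
  proof
    fix w assume "w \<in> f ` S"
    then obtain y where y: "star y = y" "norm y \<le> 1/2" and w: "w = f y"
      by (auto simp: S_def)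
    have "norm (h + y * y) \<le> norm h + norm y * norm y"
      using norm_triangle_ineq[of h "y * y"] norm_mult_ineq[of y y] by linarith
    also have "\<dots> \<le> 3/4 + 1/2 * (1/2)"
      using y assms(2) by (intro add_mono mult_mono) auto
    finally have "norm w \<le> 1/2" by (simp add: w f_def)
    moreover have "star w = w"
      using y assms(1) by (simp add: w f_def star_scaleR star_add star_mult)
    ultimately show "w \<in> S" by (simp add: S_def)
  qed
  moreover have "dist (f y) (f y') \<le> 1/2 * dist y y'" if "y \<in> S \<and> y' \<in> S" for y y'
  proof -
    have yy: "norm y \<le> 1/2" "norm y' \<le> 1/2" using that by (auto simp: S_def)
    \<comment> \<open>The elements need not commute, so \<open>y\<^sup>2 - y'\<^sup>2\<close> is split asymmetrically.\<close>
    have "f y - f y' = (1/2) *\<^sub>R (y * (y - y') + (y - y') * y')"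
      by (simp add: f_def algebra_simps flip: scaleR_add_right scaleR_diff_right)
    then have "norm (f y - f y') \<le> 1/2 * (norm (y * (y - y')) + norm ((y - y') * y'))"
      using norm_triangle_ineq[of "y * (y - y')" "(y - y') * y'"] by simp
    also have "\<dots> \<le> 1/2 * (1/2 * norm (y - y') + norm (y - y') * (1/2))"
      using yy norm_mult_ineq[of y "y - y'"] norm_mult_ineq[of "y - y'" y']
        mult_right_mono[OF yy(1), of "norm (y - y')"] mult_left_mono[OF yy(2), of "norm (y - y')"]
      by (intro mult_left_mono add_mono) auto
    finally show ?thesis by (simp add: dist_norm)
  qed
  ultimately have "\<exists>!y. y \<in> S \<and> f y = y"
    using Banach_fix[of S "1/2" f] by auto
  then obtain y where y: "y \<in> S" "f y = y" by auto
  have "y * y = 2 *\<^sub>R y - h"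
  proof -
    have "2 *\<^sub>R f y = h + y * y" by (simp add: f_def)
    then show ?thesis by (simp add: y(2))
  qed
  then have "(1 - y) * (1 - y) = 1 - h"
    by (simp add: algebra_simps scaleR_2)
  moreover have "star (1 - y) = 1 - y" using y by (simp add: S_def star_diff)
  ultimately show ?thesis by blast
qed

section \<open>States\<close>

context
  fixes \<omega> :: "'a::cstar_algebra \<Rightarrow> complex"
  assumes state: "state \<omega>"
begin

lemma state_add: "\<omega> (x + y) = \<omega> x + \<omega> y"
  and state_scaleC: "\<omega> (scaleC c x) = c * \<omega> x"
  and state_one: "\<omega> 1 = 1"
  using state by (auto simp: state_def)

lemma state_positive: "\<omega> (star x * x) \<in> \<real>\<^sub>\<ge>\<^sub>0"
  using state by (auto simp: state_def)

lemma state_zero: "\<omega> 0 = 0"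
  using state_scaleC[of 0 0] by simp

lemma state_minus: "\<omega> (- x) = - \<omega> x"
  using state_scaleC[of "-1" x] by (simp add: scaleC_minus_one)

lemma state_diff: "\<omega> (x - y) = \<omega> x - \<omega> y"
  using state_add[of x "- y"] by (simp add: state_minus)

lemma state_scaleR: "\<omega> (r *\<^sub>R x) = r *\<^sub>R \<omega> x"
  using state_scaleC[of "of_real r" x] by (simp add: scaleC_of_real scaleR_conv_of_real)

lemma state_sum: "\<omega> (\<Sum>i\<in>I. f i) = (\<Sum>i\<in>I. \<omega> (f i))"
  by (induction I rule: infinite_finite_induct) (simp_all add: state_add state_zero)

lemmas state_linear = state_add state_scaleC state_diff state_sum state_one state_zero

lemma state_star_mult_self: "\<omega> (star x * x) = of_real (Re (\<omega> (star x * x)))"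
  and state_positive_Re: "0 \<le> Re (\<omega> (star x * x))"
  using state_positive[of x] by (auto simp: nonneg_Reals_def)

text \<open>
  Positivity makes \<open>\<omega>((1 + y)\<^sup>* (1 + y))\<close> real, hence also \<open>\<omega>(y\<^sup>*) + \<omega>(y)\<close>; taking
  \<open>y = x\<close> and \<open>y = \<i> x\<close> gives both components of the claim.
\<close>

lemma state_star: "\<omega> (star x) = cnj (\<omega> x)"
proof -
  have *: "Im (\<omega> (star y) + \<omega> y) = 0" for y
  proof -
    have "\<omega> (star (1 + y) * (1 + y)) = 1 + (\<omega> (star y) + \<omega> y) + \<omega> (star y * y)"
      by (simp add: star_add algebra_simps state_linear)
    then show ?thesis
      using state_star_mult_self[of "1 + y"] state_star_mult_self[of y]
      by (metis Im_complex_of_real add_cancel_left_left one_complex.simps(2) plus_complex.simps(2))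
  qed
  show ?thesis
    using *[of x] *[of "scaleC \<i> x"]
    by (simp add: complex_eq_iff star_scaleC state_linear)
qed

lemma state_Cauchy_Schwarz:
  "(cmod (\<omega> (star y * x)))\<^sup>2 \<le> Re (\<omega> (star x * x)) * Re (\<omega> (star y * y))"
proof -
  define w A B where "w = \<omega> (star y * x)" and "A = Re (\<omega> (star x * x))" and "B = Re (\<omega> (star y * y))"
  have A: "\<omega> (star x * x) = of_real A" and B: "\<omega> (star y * y) = of_real B"
    using state_star_mult_self unfolding A_def B_def by auto
  have w': "\<omega> (star x * y) = cnj w"
    using state_star[of "star y * x"] by (simp add: star_mult star_star w_def)
  have key: "0 \<le> A - 2 * t * (cmod w)\<^sup>2 + t\<^sup>2 * (cmod w)\<^sup>2 * B" for t :: real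
  proof -
    \<comment> \<open>Positivity at \<open>x - t w y\<close>, a quadratic polynomial in the real variable \<open>t\<close>.\<close>
    define c where "c = of_real t * w"
    have "\<omega> (star (x - scaleC c y) * (x - scaleC c y))
        = of_real A - c * cnj w - cnj c * w + cnj c * c * of_real B"
      by (simp add: star_diff star_scaleC algebra_simps mult_scaleC_left mult_scaleC_right
          scaleC_scaleC state_linear A B w' w_def[symmetric])
    also have "\<dots> = of_real A - 2 * of_real t * (w * cnj w) + (of_real t)\<^sup>2 * (w * cnj w) * of_real B"
      by (simp add: c_def power2_eq_square algebra_simps)
    also have "\<dots> = of_real (A - 2 * t * (cmod w)\<^sup>2 + t\<^sup>2 * (cmod w)\<^sup>2 * B)"
      by (simp flip: complex_norm_square)
    finally show ?thesis using state_positive_Re[of "x - scaleC c y"] by simp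
  qed
  have A0: "0 \<le> A" and B0: "0 \<le> B" using state_positive_Re by (auto simp: A_def B_def)
  have "(cmod w)\<^sup>2 \<le> A * B"
  proof (cases "B = 0")
    case True
    have "(cmod w)\<^sup>2 = 0"
    proof (rule ccontr)
      assume "(cmod w)\<^sup>2 \<noteq> 0"
      \<comment> \<open>Here the polynomial is affine with negative slope; at this \<open>t\<close> it takes the value \<open>-1\<close>.\<close>
      then show False using key[of "(A + 1) / (2 * (cmod w)\<^sup>2)"] True by (simp add: field_simps)
    qed
    then show ?thesis using True by simp
  next
    case False
    then show ?thesis using key[of "1 / B"] B0 by (simp add: field_simps power2_eq_square)
  qed
  then show ?thesis by (simp add: w_def A_def B_def)
qed

lemma state_norm_square_le: "(cmod (\<omega> x))\<^sup>2 \<le> Re (\<omega> (star x * x))"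
  using state_Cauchy_Schwarz[of 1 x] by (simp add: state_one)

text \<open>
  Scaled to norm \<open>3/4\<close>, the element \<open>h = c x\<^sup>* x\<close> has \<open>1 - h = k\<^sup>* k\<close>, so \<open>\<omega>(h) \<le> 1\<close>. The
  optimal constant is \<open>1\<close>, but only continuity of states matters for the density argument.
\<close>

lemma state_bounded: "cmod (\<omega> x) \<le> 2 * norm x"
proof (cases "x = 0")
  case False
  define c where "c = (3/4) / (norm x)\<^sup>2"
  have c: "c > 0" using False by (simp add: c_def)
  have "norm (c *\<^sub>R (star x * x)) \<le> 3/4"
    using False by (simp add: c_def cstar_identity)
  moreover have "star (c *\<^sub>R (star x * x)) = c *\<^sub>R (star x * x)"
    by (simp add: star_scaleR star_mult star_star)
  ultimately obtain k where "star k = k" "k * k = 1 - c *\<^sub>R (star x * x)"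
    using self_adjoint_sqrt_one_minus by blast
  then have "0 \<le> Re (\<omega> (1 - c *\<^sub>R (star x * x)))"
    using state_positive_Re[of k] by simp
  then have "c * Re (\<omega> (star x * x)) \<le> 1"
    by (simp add: state_linear state_scaleR)
  then have "c * (cmod (\<omega> x))\<^sup>2 \<le> 1"
    using mult_left_mono[OF state_norm_square_le[of x], of c] c by linarith
  then have "3 * (cmod (\<omega> x))\<^sup>2 \<le> 4 * (norm x)\<^sup>2"
    using False by (simp add: c_def field_simps)
  then have "(cmod (\<omega> x))\<^sup>2 \<le> (2 * norm x)\<^sup>2"
    using zero_le_power2[of "cmod (\<omega> x)"] unfolding four_x_squared[symmetric] by linarith
  then show ?thesis by (rule power2_le_imp_le) simp
qed (simp add: state_zero)

lemma bounded_linear_state: "bounded_linear \<omega>"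
  by (rule bounded_linear_intro[where K=2])
    (use state_bounded in \<open>auto simp: state_add state_scaleR mult.commute\<close>)

text \<open>
  In the GNS representation, a unit vector \<open>\<Omega>\<close> with \<open>\<langle>\<Omega>, v\<Omega>\<rangle> = 1\<close> for an isometry \<open>v\<close> satisfies
  \<open>v\<Omega> = \<Omega>\<close>, because \<open>\<parallel>v\<Omega> - \<Omega>\<parallel>\<^sup>2 = 0\<close>.
\<close>

lemma state_fixed_isometry:
  assumes "star v * v = 1" and "\<omega> v = 1"
  shows "\<omega> (x * v) = \<omega> x"
proof -
  have "\<omega> (star (v - 1) * (v - 1)) = 0"
    using assms by (simp add: star_diff left_diff_distrib right_diff_distrib state_linear state_star)
  then have "(cmod (\<omega> (x * (v - 1))))\<^sup>2 \<le> 0"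
    using state_Cauchy_Schwarz[of "star x" "v - 1"] by (simp add: star_star)
  then show ?thesis by (simp add: algebra_simps state_diff)
qed

end

section \<open>Closed linear spans\<close>

lemma subspace_closure:
  fixes S :: "'a::real_normed_vector set"
  assumes "subspace S"
  shows "subspace (closure S)"
proof (rule subspaceI)
  show "0 \<in> closure S" using assms closure_subset subspace_0 by blast
  show "x + y \<in> closure S" if xy: "x \<in> closure S" "y \<in> closure S" for x y
  proof -
    obtain f g where "\<forall>i. f i \<in> S" "f \<longlonglongrightarrow> x" "\<forall>i. g i \<in> S" "g \<longlonglongrightarrow> y"
      using xy unfolding closure_sequential by blast
    then have "(\<forall>i. f i + g i \<in> S) \<and> (\<lambda>i. f i + g i) \<longlonglongrightarrow> x + y"
      using assms by (simp add: subspace_add tendsto_add)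
    then show ?thesis unfolding closure_sequential by (intro exI[of _ "\<lambda>i. f i + g i"])
  qed
  show "c *\<^sub>R x \<in> closure S" if x: "x \<in> closure S" for c x
  proof -
    obtain f where "\<forall>i. f i \<in> S" "f \<longlonglongrightarrow> x"
      using x unfolding closure_sequential by blast
    then have "(\<forall>i. c *\<^sub>R f i \<in> S) \<and> (\<lambda>i. c *\<^sub>R f i) \<longlonglongrightarrow> c *\<^sub>R x"
      using assms by (simp add: subspace_scale tendsto_scaleR)
    then show ?thesis unfolding closure_sequential by (intro exI[of _ "\<lambda>i. c *\<^sub>R f i"])
  qed
qed

text \<open>
  Products are treated one factor at a time: first \<open>x\<close> in the closed span and \<open>y\<close> in \<open>M\<close>, then \<open>y\<close>
  in the span by linearity, then \<open>y\<close> in its closure by continuity.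
\<close>

lemma cstar_subalgebra_closure_span:
  fixes M :: "'a::cstar_algebra set"
  assumes one: "1 \<in> M"
    and mult: "\<And>x y. x \<in> M \<Longrightarrow> y \<in> M \<Longrightarrow> x * y \<in> M"
    and scale: "\<And>c x. x \<in> M \<Longrightarrow> scaleC c x \<in> M"
    and star: "\<And>x. x \<in> M \<Longrightarrow> star x \<in> M"
  shows "cstar_subalgebra (closure (span M))"
proof -
  interpret scaleC: bounded_linear "scaleC c :: 'a \<Rightarrow> 'a" for c by (rule bounded_linear_scaleC)
  interpret star: bounded_linear "star :: 'a \<Rightarrow> 'a" by (rule bounded_linear_star)
  have sub: "subspace (closure (span M))"
    by (intro subspace_closure subspace_span)
  have image: "f x \<in> closure (span M)"
    if f: "bounded_linear f" and fM: "f ` span M \<subseteq> span M" and x: "x \<in> closure (span M)"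
    for f :: "'a \<Rightarrow> 'a" and x
  proof -
    have "f ` closure (span M) \<subseteq> closure (span M)"
    proof (rule image_closure_subset)
      show "continuous_on (closure (span M)) f" using f by (rule linear_continuous_on)
      show "f ` span M \<subseteq> closure (span M)" using fM closure_subset by blast
    qed simp
    with x show ?thesis by blast
  qed
  have span_image: "f ` span M \<subseteq> span M" if "linear f" "f ` M \<subseteq> span M" for f :: "'a \<Rightarrow> 'a"
    using that by (metis span_minimal linear_span_image subspace_span)
  have right: "x * y \<in> closure (span M)" if "x \<in> closure (span M)" "y \<in> M" for x y
    using that mult
    by (intro image[where f="\<lambda>x. x * y"] span_image bounded_linear_mult_left
        bounded_linear.linear[OF bounded_linear_mult_left]) (auto intro: span_base)
  have span_right: "x * y \<in> closure (span M)" if x: "x \<in> closure (span M)" and "y \<in> span M" for x y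
    using that(2)
  proof (induction rule: span_induct_alt)
    case base
    show ?case using subspace_0[OF sub] by simp
  next
    case (step c y y')
    then show ?case
      using right[OF x step(1)] sub
      by (simp add: distrib_left subspace_add subspace_scale)
  qed
  have "x * y \<in> closure (span M)" if x: "x \<in> closure (span M)" and y: "y \<in> closure (span M)" for x y
  proof -
    have "(\<lambda>y. x * y) ` closure (span M) \<subseteq> closure (span M)"
      using span_right[OF x]
      by (intro image_closure_subset linear_continuous_on bounded_linear_mult_right) auto
    with y show ?thesis by blast
  qed
  moreover have "1 \<in> closure (span M)"
    using one closure_subset span_base by blast
  moreover have "scaleC c x \<in> closure (span M)" if "x \<in> closure (span M)" for c x
    using that scale
    by (intro image[where f="scaleC c"] span_image bounded_linear_scaleC scaleC.linear)
      (auto intro: span_base)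
  moreover have "star x \<in> closure (span M)" if "x \<in> closure (span M)" for x
    using that star
    by (intro image[where f=star] span_image bounded_linear_star star.linear)
      (auto intro: span_base)
  ultimately show ?thesis
    using sub by (simp add: cstar_subalgebra_def subspace_add)
qed

lemma states_eq_if_eq_on_total_set:
  assumes "state \<omega>" and "state \<omega>'" and "closure (span M) = UNIV"
    and eq: "\<And>x. x \<in> M \<Longrightarrow> \<omega> x = \<omega>' x"
  shows "\<omega> = \<omega>'"
proof -
  interpret l: bounded_linear \<omega> by (rule bounded_linear_state[OF assms(1)])
  interpret l': bounded_linear \<omega>' by (rule bounded_linear_state[OF assms(2)])
  let ?E = "{x. \<omega> x = \<omega>' x}"
  have "subspace ?E"
    by (simp add: subspace_def l.add l.scaleR l.zero l'.add l'.scaleR l'.zero)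
  then have "span M \<subseteq> ?E" by (intro span_minimal) (use eq in auto)
  moreover have "closed ?E"
    using linear_continuous_on[OF l.bounded_linear_axioms] linear_continuous_on[OF l'.bounded_linear_axioms]
    by (intro closed_Collect_eq)
  ultimately have "closure (span M) \<subseteq> ?E" by (rule closure_minimal)
  with assms(3) show ?thesis by auto
qed

section \<open>Words and tensors\<close>

lemma words_0: "words n 0 = {[]}"
  by (auto simp: words_def)

lemma words_Suc: "words n (Suc k) = (\<lambda>(i, J). i # J) ` ({1..n} \<times> words n k)"
  by (fastforce simp: words_def length_Suc_conv image_iff)

lemma finite_words [simp]: "finite (words n k)"
  using finite_lists_length_eq[of "{1..n}" k] by (simp add: words_def lists_eq_set Collect_conj_eq)

lemma sum_words_Suc:
  fixes f :: "nat list \<Rightarrow> 'b::comm_monoid_add"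
  shows "(\<Sum>J\<in>words n (Suc k). f J) = (\<Sum>i=1..n. \<Sum>J\<in>words n k. f (i # J))"
  unfolding words_Suc
  by (subst sum.reindex) (auto simp: inj_on_def sum.cartesian_product split_def)

lemma append_in_words: "J \<in> words n a \<Longrightarrow> K \<in> words n b \<Longrightarrow> J @ K \<in> words n (a + b)"
  by (auto simp: words_def)

lemma take_in_words: "J \<in> words n (a + b) \<Longrightarrow> take a J \<in> words n a"
  and drop_in_words: "J \<in> words n (a + b) \<Longrightarrow> drop a J \<in> words n b"
  by (auto simp: words_def lists_eq_set dest: in_set_takeD in_set_dropD)

lemma length_words: "J \<in> words n k \<Longrightarrow> length J = k"
  by (simp add: words_def)

lemma sum_words_add:
  fixes f :: "nat list \<Rightarrow> 'b::comm_monoid_add"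
  shows "(\<Sum>J\<in>words n (a + b). f J) = (\<Sum>J\<in>words n a. \<Sum>K\<in>words n b. f (J @ K))"
  by (induction a arbitrary: f) (simp_all add: words_0 sum_words_Suc)

lemma tensor_append: "J \<in> words n a \<Longrightarrow> tensor a x y (J @ K) = x J * y K"
  by (simp add: tensor_def length_words)

lemma tensor_in_tensor_space:
  assumes "x \<in> tensor_space n a" "y \<in> tensor_space n b"
  shows "tensor a x y \<in> tensor_space n (a + b)"
proof -
  have "J \<in> words n (a + b)" if "take a J \<in> words n a" "drop a J \<in> words n b" for J
    using append_in_words[OF that] by simp
  then show ?thesis using assms by (fastforce simp: tensor_space_def tensor_def)
qed

lemma tensor_assoc: "tensor a x (tensor b y w) = tensor (a + b) (tensor a x y) w"
  by (simp add: tensor_def fun_eq_iff drop_take add.commute mult.assoc min_def)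

lemma tensor_scale_left: "tensor a (\<lambda>J. c * x J) y = (\<lambda>J. c * tensor a x y J)"
  and tensor_scale_right: "tensor a x (\<lambda>J. c * y J) = (\<lambda>J. c * tensor a x y J)"
  by (simp_all add: tensor_def fun_eq_iff)

lemma tensor_unit_left: "tensor 0 (\<lambda>J. if J = [] then 1 else 0) x = x"
  by (simp add: tensor_def)

lemma tensor_power_in_tensor_space:
  assumes "x \<in> tensor_space n k"
  shows "tensor_power k x p \<in> tensor_space n (p * k)"
  using assms
  by (induction p) (simp_all add: tensor_in_tensor_space, simp add: tensor_space_def words_0)

lemma tensor_power_add:
  "tensor_power k x (p + q) = tensor (k * p) (tensor_power k x p) (tensor_power k x q)"
  by (induction p) (simp_all add: tensor_unit_left tensor_assoc)

lemma tensor_power_scale: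
  "tensor_power k (\<lambda>J. r * x J) p = (\<lambda>J. r ^ p * tensor_power k x p J)"
  by (induction p) (simp_all add: tensor_scale_left tensor_scale_right mult.assoc)

lemma tensor_power_1:
  assumes "x \<in> tensor_space n k"
  shows "tensor_power k x 1 = x"
proof
  fix J
  show "tensor_power k x 1 J = x J"
    using assms by (cases "length J \<le> k") (auto simp: tensor_def tensor_space_def words_def)
qed

section \<open>Commuting tensors\<close>

text \<open>
  One step of the Euclidean algorithm for commuting tensors. Evaluating \<open>u \<otimes> v = v \<otimes> u\<close> at words
  ending in a word \<open>K\<close> with \<open>v\<^sub>K \<noteq> 0\<close> exhibits \<open>v\<close> as a left factor of \<open>u\<close>; the cofactor \<open>w\<close> then
  commutes with \<open>v\<close> by cancelling \<open>v\<close> on the left.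
\<close>

lemma tensor_commute_divide:
  assumes u: "u \<in> tensor_space n a" and v: "v \<in> tensor_space n b" and "b \<le> a"
    and "u \<noteq> (\<lambda>J. 0)" and "v \<noteq> (\<lambda>J. 0)"
    and commute: "tensor a u v = tensor b v u"
  obtains w where "w \<in> tensor_space n (a - b)" "w \<noteq> (\<lambda>J. 0)"
    "u = tensor b v w" "tensor (a - b) w v = tensor b v w"
proof -
  obtain K where K: "v K \<noteq> 0" using \<open>v \<noteq> (\<lambda>J. 0)\<close> by auto
  then have Kw: "K \<in> words n b" using v by (auto simp: tensor_space_def)
  define w where "w J = (if J \<in> words n (a - b) then u (J @ K) / v K else 0)" for J
  have w: "w \<in> tensor_space n (a - b)" by (simp add: w_def tensor_space_def)
  have vw: "tensor b v w \<in> tensor_space n a"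
    using tensor_in_tensor_space[OF v w] \<open>b \<le> a\<close> by simp
  have uvw: "u J = tensor b v w J" for J
  proof (cases "J \<in> words n a")
    case True
    with \<open>b \<le> a\<close> have "drop b J \<in> words n (a - b)"
      using drop_in_words[of J n b "a - b"] by simp
    moreover have "u J * v K = v (take b J) * u (drop b J @ K)"
      using fun_cong[OF commute, of "J @ K"] True \<open>b \<le> a\<close>
      by (simp add: tensor_def length_words)
    ultimately show ?thesis using K by (simp add: tensor_def w_def field_simps)
  next
    case False
    then show ?thesis using u vw by (simp add: tensor_space_def)
  qed
  have "tensor (a - b) w v X = tensor b v w X" for X
  proof -
    \<comment> \<open>Evaluation at \<open>KX\<close> cancels the left factor \<open>v\<close> of both sides of \<open>v \<otimes> w \<otimes> v = v \<otimes> v \<otimes> w\<close>.\<close>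
    have "u (K @ take (a - b) X) * v (drop (a - b) X) = v K * u X"
      using fun_cong[OF commute, of "K @ X"] length_words[OF Kw] \<open>b \<le> a\<close>
      by (simp add: tensor_def)
    moreover have "u (K @ take (a - b) X) = v K * w (take (a - b) X)"
      by (simp add: uvw tensor_def length_words[OF Kw])
    ultimately show ?thesis using K by (simp add: uvw[of X] tensor_def[of "a - b"])
  qed
  moreover have "w \<noteq> (\<lambda>J. 0)"
    using \<open>u \<noteq> (\<lambda>J. 0)\<close> uvw by (auto simp: tensor_def)
  ultimately show ?thesis using that[OF w] uvw by blast
qed

text \<open>
  Degree \<open>0\<close> is included on purpose (a scalar is a multiple of the zeroth power of any tensor):
  the Euclidean algorithm stops there.
\<close>

definition common_tensor_root ::
  "nat \<Rightarrow> nat \<Rightarrow> (nat list \<Rightarrow> complex) \<Rightarrow> nat \<Rightarrow> (nat list \<Rightarrow> complex) \<Rightarrow> bool"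
  where "common_tensor_root n a u b v \<longleftrightarrow>
    (\<exists>d x p q c c'. 1 \<le> d \<and> x \<in> tensor_space n d \<and> a = d * p \<and> b = d * q \<and>
       u = (\<lambda>J. c * tensor_power d x p J) \<and> v = (\<lambda>J. c' * tensor_power d x q J))"

lemma common_tensor_root_sym: "common_tensor_root n a u b v \<Longrightarrow> common_tensor_root n b v a u"
  unfolding common_tensor_root_def by blast

text \<open>
  This is the tensor analogue of the fact that commuting words are powers of a common word. Repeatedly
  dividing the tensor of larger degree by the other one ends with a scalar and a common root.
\<close>

lemma commuting_tensors_common_root:
  assumes "u \<in> tensor_space n a" and "v \<in> tensor_space n b"
    and "u \<noteq> (\<lambda>J. 0)" and "v \<noteq> (\<lambda>J. 0)"
    and "tensor a u v = tensor b v u" and "1 \<le> a + b"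
  shows "common_tensor_root n a u b v"
  using assms
proof (induction "a + b" arbitrary: a u b v rule: less_induct)
  case less
  have step: "common_tensor_root n a' u' b' v'"
    if sum: "a' + b' = a + b" and le: "b' \<le> a'"
      and u: "u' \<in> tensor_space n a'" and v: "v' \<in> tensor_space n b'"
      and nz: "u' \<noteq> (\<lambda>J. 0)" "v' \<noteq> (\<lambda>J. 0)"
      and commute: "tensor a' u' v' = tensor b' v' u'"
    for a' b' u' v'
  proof (cases "b' = 0")
    case True
    have "v' = (\<lambda>J. v' [] * (if J = [] then 1 else 0))"
      using v True by (auto simp: tensor_space_def words_0)
    then have "u' = (\<lambda>J. 1 * tensor_power a' u' 1 J) \<and> v' = (\<lambda>J. v' [] * tensor_power a' u' 0 J)"
      using tensor_power_1[OF u] by simp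
    moreover have "1 \<le> a'" "a' = a' * 1" "b' = a' * 0" using True sum less.prems(6) by auto
    ultimately show ?thesis using u unfolding common_tensor_root_def by blast
  next
    case False
    obtain w where w: "w \<in> tensor_space n (a' - b')" "w \<noteq> (\<lambda>J. 0)"
      and uvw: "u' = tensor b' v' w" and wv: "tensor (a' - b') w v' = tensor b' v' w"
      using tensor_commute_divide[OF u v le nz commute] by blast
    have "common_tensor_root n (a' - b') w b' v'"
      using less.hyps[of "a' - b'" b' w v'] False sum le w v nz(2) wv by simp
    then obtain d x p q c c' where d: "1 \<le> d" "x \<in> tensor_space n d"
      and a: "a' - b' = d * p" and b: "b' = d * q"
      and wx: "w = (\<lambda>J. c * tensor_power d x p J)" and vx: "v' = (\<lambda>J. c' * tensor_power d x q J)"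
      unfolding common_tensor_root_def by blast
    have "u' = (\<lambda>J. (c' * c) * tensor_power d x (q + p) J)"
      by (simp add: uvw wx vx b tensor_scale_left tensor_scale_right tensor_power_add mult.assoc)
    moreover have "a' = d * (q + p)" using a b le by (simp add: distrib_left)
    ultimately show ?thesis using d b vx unfolding common_tensor_root_def by blast
  qed
  show ?case
  proof (cases "b \<le> a")
    case True
    then show ?thesis using less.prems by (intro step) auto
  next
    case False
    then have "common_tensor_root n b v a u" using less.prems by (intro step) auto
    then show ?thesis by (rule common_tensor_root_sym)
  qed
qed

text \<open>
  The common root \<open>x\<close> gives \<open>z = c x\<^sup>\<otimes>\<^sup>p\<close>. Over the complex numbers \<open>c\<close> has a \<open>p\<close>-th root, which can be
  absorbed into \<open>x\<close>, so nonperiodicity yields \<open>p = 1\<close>; then the degree of \<open>y\<close> is a multiple of \<open>m\<close>.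
\<close>

lemma nonperiodic_commuting_degree:
  assumes "nonperiodic n z" and z: "z \<in> tensor_space n m" "z \<noteq> (\<lambda>J. 0)"
    and y: "y \<in> tensor_space n k" "y \<noteq> (\<lambda>J. 0)"
    and commute: "tensor m z y = tensor k y z" and "1 \<le> m" "1 \<le> k"
  shows "m \<le> k"
proof -
  obtain d x p q c where d: "1 \<le> d" and x: "x \<in> tensor_space n d"
    and m: "m = d * p" and k: "k = d * q" and zx: "z = (\<lambda>J. c * tensor_power d x p J)"
    using commuting_tensors_common_root[OF z(1) y(1) z(2) y(2) commute] \<open>1 \<le> m\<close>
    unfolding common_tensor_root_def by auto
  have p: "1 \<le> p" and q: "1 \<le> q" using m k \<open>1 \<le> m\<close> \<open>1 \<le> k\<close> by (cases p; cases q; simp)+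
  obtain r where r: "c = r ^ p" using exists_complex_root[of p c] p by auto
  have "z = tensor_power d (\<lambda>J. r * x J) p"
    by (simp add: zx r tensor_power_scale)
  moreover have "(\<lambda>J. r * x J) \<in> tensor_space n d" using x by (simp add: tensor_space_def)
  ultimately have "p = 1" using assms(1) p d unfolding nonperiodic_def by blast
  then show ?thesis using m k q by simp
qed

lemma unit_vector_inner_self:
  assumes "x \<in> unit_vectors n k"
  shows "(\<Sum>J\<in>words n k. x J * cnj (x J)) = 1"
proof -
  have "(\<Sum>J\<in>words n k. x J * cnj (x J)) = of_real (\<Sum>J\<in>words n k. (cmod (x J))\<^sup>2)"
    unfolding of_real_sum complex_norm_square ..
  also have "(\<Sum>J\<in>words n k. (cmod (x J))\<^sup>2) = 1"
    using assms by (simp add: unit_vectors_def)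
  finally show ?thesis by simp
qed

lemma sum_cmod_square_tensor:
  "(\<Sum>J\<in>words n (a + b). (cmod (tensor a x y J))\<^sup>2) =
    (\<Sum>J\<in>words n a. (cmod (x J))\<^sup>2) * (\<Sum>J\<in>words n b. (cmod (y J))\<^sup>2)"
  by (simp add: sum_words_add tensor_append norm_mult power_mult_distrib sum_product)

lemma sum_cmod_square_tensor_power:
  "(\<Sum>J\<in>words n (k * p). (cmod (tensor_power k x p J))\<^sup>2) = (\<Sum>J\<in>words n k. (cmod (x J))\<^sup>2) ^ p"
  by (induction p) (simp_all add: words_0 sum_cmod_square_tensor)

text \<open>
  The hypothesis says that contracting \<open>z \<otimes> y\<close> with the unit vector \<open>z\<close> on the last \<open>m\<close> factors
  gives \<open>y\<close>. Hence \<open>\<langle>y \<otimes> z, z \<otimes> y\<rangle> = \<parallel>y\<parallel>\<^sup>2\<close>; both tensors have norm \<open>\<parallel>y\<parallel>\<close>, so this is equality in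
  the Cauchy-Schwarz inequality and their distance vanishes.
\<close>

lemma tensor_eq_if_contraction_isometric:
  assumes y: "y \<in> tensor_space n k" and z: "z \<in> unit_vectors n m"
    and contraction: "\<And>K. K \<in> words n k \<Longrightarrow>
      y K = (\<Sum>J\<in>words n m. cnj (z J) * tensor m z y (K @ J))"
  shows "tensor m z y = tensor k y z"
proof -
  let ?u = "tensor m z y" and ?v = "tensor k y z" and ?W = "words n (k + m)"
  have zs: "z \<in> tensor_space n m" and z1: "(\<Sum>J\<in>words n m. (cmod (z J))\<^sup>2) = 1"
    using z by (auto simp: unit_vectors_def)
  define N where "N = (\<Sum>K\<in>words n k. (cmod (y K))\<^sup>2)"
  have u: "(\<Sum>X\<in>?W. (cmod (?u X))\<^sup>2) = N"
    using sum_cmod_square_tensor[of m z y n k] z1 by (simp add: N_def add.commute)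
  have v: "(\<Sum>X\<in>?W. (cmod (?v X))\<^sup>2) = N"
    using sum_cmod_square_tensor[of k y z n m] z1 by (simp add: N_def)
  have "(\<Sum>X\<in>?W. cnj (?v X) * ?u X)
      = (\<Sum>K\<in>words n k. cnj (y K) * (\<Sum>J\<in>words n m. cnj (z J) * ?u (K @ J)))"
    by (simp add: sum_words_add tensor_append sum_distrib_left mult.assoc)
  also have "\<dots> = (\<Sum>K\<in>words n k. cnj (y K) * y K)"
    using contraction by simp
  also have "\<dots> = of_real N"
    unfolding N_def of_real_sum complex_norm_square by (simp add: mult.commute)
  finally have uv: "Re (\<Sum>X\<in>?W. cnj (?v X) * ?u X) = N" by simp
  have "(cmod (a - b))\<^sup>2 = (cmod a)\<^sup>2 + (cmod b)\<^sup>2 - 2 * Re (cnj b * a)" for a b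
    by (simp add: cmod_power2 power2_diff algebra_simps)
  then have "(\<Sum>X\<in>?W. (cmod (?u X - ?v X))\<^sup>2) = 0"
    using u v uv by (simp add: sum.distrib sum_subtractf flip: sum_distrib_left)
  then have "?u X = ?v X" if "X \<in> ?W" for X
    using that by (simp add: sum_nonneg_eq_0_iff)
  moreover have "?u X = ?v X" if "X \<notin> ?W" for X
    using tensor_in_tensor_space[OF zs y] tensor_in_tensor_space[OF y zs] that
    by (simp add: tensor_space_def add.commute)
  ultimately show ?thesis by blast
qed

section \<open>Cuntz families\<close>

text \<open>
  On the full Fock space with \<open>s\<close> the left creation operators, this is left tensor multiplication
  by \<open>x\<close>.
\<close>

definition creation :: "nat \<Rightarrow> (nat \<Rightarrow> 'a::cstar_algebra) \<Rightarrow> nat \<Rightarrow> (nat list \<Rightarrow> complex) \<Rightarrow> 'a" where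
  "creation n s k x = (\<Sum>J\<in>words n k. scaleC (x J) (word_prod s J))"

lemma word_prod_Nil [simp]: "word_prod s [] = 1"
  and word_prod_Cons [simp]: "word_prod s (i # J) = s i * word_prod s J"
  and word_prod_append: "word_prod s (J @ K) = word_prod s J * word_prod s K"
  by (simp_all add: word_prod_def)

definition cuntz_monomials :: "nat \<Rightarrow> (nat \<Rightarrow> 'a::cstar_algebra) \<Rightarrow> 'a set" where
  "cuntz_monomials n s =
    {scaleC c (word_prod s J * star (word_prod s K)) | c J K. J \<in> lists {1..n} \<and> K \<in> lists {1..n}}"

lemma creation_tensor:
  "creation n s (a + b) (tensor a x y) = creation n s a x * creation n s b y"
  by (simp add: creation_def sum_words_add tensor_append word_prod_append sum_product
      mult_scaleC_left mult_scaleC_right scaleC_scaleC mult.commute)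

lemma creation_tensor_power: "creation n s (k * p) (tensor_power k x p) = creation n s k x ^ p"
  by (induction p) (simp_all add: creation_tensor, simp add: creation_def words_0)

context
  fixes n :: nat and s :: "nat \<Rightarrow> 'a::cstar_algebra"
  assumes cuntz: "cuntz_family type_struct n s"
begin

lemma star_generator_mult:
  "i \<in> {1..n} \<Longrightarrow> j \<in> {1..n} \<Longrightarrow> star (s i) * s j = (if i = j then 1 else 0)"
  and sum_range_projections: "(\<Sum>i=1..n. s i * star (s i)) = 1"
  using cuntz by (auto simp: cuntz_family_type_struct)

lemma star_word_mult_word:
  assumes "J \<in> words n k" and "K \<in> words n k"
  shows "star (word_prod s J) * word_prod s K = (if J = K then 1 else 0)"
  using assms
proof (induction k arbitrary: J K)
  case 0
  then show ?case by (simp add: words_0)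
next
  case (Suc k)
  then obtain i J' j K' where JK: "J = i # J'" "K = j # K'"
    "i \<in> {1..n}" "j \<in> {1..n}" "J' \<in> words n k" "K' \<in> words n k"
    by (auto simp: words_Suc)
  have "star (word_prod s J) * word_prod s K
      = star (word_prod s J') * (star (s i) * s j) * word_prod s K'"
    by (simp add: JK star_mult mult.assoc)
  also have "\<dots> = (if J = K then 1 else 0)"
    by (simp add: Suc.IH[OF JK(5,6)] Suc.IH[OF JK(6,6)] star_generator_mult[OF JK(3,4)] JK(1,2))
  finally show ?case .
qed

lemma sum_word_projections: "(\<Sum>J\<in>words n k. word_prod s J * star (word_prod s J)) = 1"
proof (induction k)
  case (Suc k)
  have "(\<Sum>J\<in>words n (Suc k). word_prod s J * star (word_prod s J))
      = (\<Sum>i=1..n. s i * (\<Sum>J\<in>words n k. word_prod s J * star (word_prod s J)) * star (s i))"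
    by (simp add: sum_words_Suc sum_distrib_left sum_distrib_right star_mult mult.assoc)
  then show ?case using sum_range_projections by (simp add: Suc)
qed (simp add: words_0)

lemma star_word_mult_creation:
  assumes "J \<in> words n k"
  shows "star (word_prod s J) * creation n s k x = scaleC (x J) 1"
proof -
  have "star (word_prod s J) * creation n s k x
      = (\<Sum>K\<in>words n k. if K = J then scaleC (x K) 1 else 0)"
    unfolding creation_def sum_distrib_left mult_scaleC_right
    by (rule sum.cong) (auto simp: star_word_mult_word[OF assms])
  then show ?thesis using assms by simp
qed

lemma creation_isometry:
  assumes "x \<in> unit_vectors n k"
  shows "star (creation n s k x) * creation n s k x = 1"
proof -
  have "star (creation n s k x) * creation n s k x
      = (\<Sum>J\<in>words n k. scaleC (cnj (x J)) (star (word_prod s J) * creation n s k x))"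
    by (simp add: creation_def[of n s k x] star_sum star_scaleC sum_distrib_right mult_scaleC_left)
  also have "\<dots> = scaleC (\<Sum>J\<in>words n k. x J * cnj (x J)) 1"
    by (simp add: star_word_mult_creation scaleC_scaleC scaleC_sum_left mult.commute)
  also have "\<dots> = 1"
    by (simp add: unit_vector_inner_self[OF assms])
  finally show ?thesis .
qed

text \<open>
  Both words can be lengthened by the same amount; this is how word lengths are brought to multiples
  of \<open>m\<close>.
\<close>

lemma word_expand:
  "word_prod s J * star (word_prod s K)
    = (\<Sum>L\<in>words n l. word_prod s (J @ L) * star (word_prod s (K @ L)))"
proof -
  have "word_prod s J * star (word_prod s K)
      = word_prod s J * (\<Sum>L\<in>words n l. word_prod s L * star (word_prod s L)) * star (word_prod s K)"
    by (simp add: sum_word_projections)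
  then show ?thesis
    by (simp add: sum_distrib_left sum_distrib_right word_prod_append star_mult mult.assoc)
qed

lemma cuntz_monomials_memI:
  "J \<in> lists {1..n} \<Longrightarrow> K \<in> lists {1..n} \<Longrightarrow>
    scaleC c (word_prod s J * star (word_prod s K)) \<in> cuntz_monomials n s"
  by (auto simp: cuntz_monomials_def)

text \<open>
  Cancelling equal leading letters with \<open>s\<^sub>i\<^sup>* s\<^sub>j = \<delta>\<^sub>i\<^sub>j\<close> leaves the rest of \<open>J\<close>, the adjoint of the
  rest of \<open>K\<close>, or \<open>0\<close>. The zero case is covered by \<open>c = 0\<close>.
\<close>

lemma star_word_mult_word_monomial:
  assumes "K \<in> lists {1..n}" and "J \<in> lists {1..n}"
  obtains c J' K' where "J' \<in> lists {1..n}" "K' \<in> lists {1..n}"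
    "star (word_prod s K) * word_prod s J = scaleC c (word_prod s J' * star (word_prod s K'))"
proof -
  have "\<exists>c. \<exists>J'\<in>lists {1..n}. \<exists>K'\<in>lists {1..n}.
      star (word_prod s K) * word_prod s J = scaleC c (word_prod s J' * star (word_prod s K'))"
    using assms
  proof (induction K arbitrary: J rule: list.induct)
    case Nil
    then show ?case by (intro exI[of _ 1] bexI[of _ J] bexI[of _ "[]"]) auto
  next
    case (Cons i K)
    show ?case
    proof (cases J)
      case Nil
      then have "star (word_prod s (i # K)) * word_prod s J
          = scaleC 1 (word_prod s [] * star (word_prod s (i # K)))" by simp
      then show ?thesis using Cons.prems(1) by blast
    next
      case (Cons j J')
      have "star (word_prod s (i # K)) * word_prod s J
          = star (word_prod s K) * (star (s i) * s j) * word_prod s J'"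
        by (simp add: Cons star_mult mult.assoc)
      also have "\<dots> = scaleC (if i = j then 1 else 0) (star (word_prod s K) * word_prod s J')"
        using star_generator_mult[of i j] Cons Cons.prems by simp
      finally have "star (word_prod s (i # K)) * word_prod s J
          = scaleC (if i = j then 1 else 0) (star (word_prod s K) * word_prod s J')" .
      moreover obtain c P Q where "P \<in> lists {1..n}" "Q \<in> lists {1..n}"
        "star (word_prod s K) * word_prod s J' = scaleC c (word_prod s P * star (word_prod s Q))"
        using Cons.IH[of J'] Cons Cons.prems by auto
      ultimately show ?thesis
        by (intro exI[of _ "(if i = j then 1 else 0) * c"] bexI[of _ P] bexI[of _ Q])
          (simp_all add: scaleC_scaleC)
    qed
  qed
  then show ?thesis using that by blast
qed

lemma cuntz_monomials_mult:
  assumes "x \<in> cuntz_monomials n s" and "y \<in> cuntz_monomials n s"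
  shows "x * y \<in> cuntz_monomials n s"
proof -
  obtain c J K where x: "x = scaleC c (word_prod s J * star (word_prod s K))"
    and JK: "J \<in> lists {1..n}" "K \<in> lists {1..n}"
    using assms(1) unfolding cuntz_monomials_def by blast
  obtain d P Q where y: "y = scaleC d (word_prod s P * star (word_prod s Q))"
    and PQ: "P \<in> lists {1..n}" "Q \<in> lists {1..n}"
    using assms(2) unfolding cuntz_monomials_def by blast
  obtain e J' K' where JK': "J' \<in> lists {1..n}" "K' \<in> lists {1..n}"
    and e: "star (word_prod s K) * word_prod s P = scaleC e (word_prod s J' * star (word_prod s K'))"
    by (rule star_word_mult_word_monomial[OF JK(2) PQ(1)])
  have "x * y = scaleC (c * d) ((word_prod s J * star (word_prod s K)) * (word_prod s P * star (word_prod s Q)))"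
    unfolding x y mult_scaleC_left mult_scaleC_right scaleC_scaleC by (simp only: mult.commute[of c d])
  also have "\<dots> = scaleC (c * d) (word_prod s J * (star (word_prod s K) * word_prod s P) * star (word_prod s Q))"
    by (simp only: mult.assoc)
  also have "\<dots> = scaleC (c * d * e) (word_prod s (J @ J') * star (word_prod s (Q @ K')))"
    unfolding e mult_scaleC_left mult_scaleC_right scaleC_scaleC word_prod_append star_mult
    by (simp only: mult.assoc)
  finally show ?thesis
    using JK PQ JK' by (simp add: cuntz_monomials_memI)
qed

lemma closure_span_cuntz_monomials:
  assumes "cstar_subalgebra hull (s ` {1..n}) = UNIV"
  shows "closure (span (cuntz_monomials n s)) = UNIV"
proof -
  have "cstar_subalgebra (closure (span (cuntz_monomials n s)))"
  proof (rule cstar_subalgebra_closure_span)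
    show "1 \<in> cuntz_monomials n s"
      using cuntz_monomials_memI[of "[]" "[]" 1] by simp
    fix x assume "x \<in> cuntz_monomials n s"
    then obtain c J K where x: "x = scaleC c (word_prod s J * star (word_prod s K))"
      and JK: "J \<in> lists {1..n}" "K \<in> lists {1..n}"
      unfolding cuntz_monomials_def by blast
    show "scaleC d x \<in> cuntz_monomials n s" for d
      unfolding x scaleC_scaleC using JK by (rule cuntz_monomials_memI)
    show "star x \<in> cuntz_monomials n s"
      unfolding x star_scaleC star_mult star_star using JK(2,1) by (rule cuntz_monomials_memI)
  qed (rule cuntz_monomials_mult)
  moreover have "s ` {1..n} \<subseteq> closure (span (cuntz_monomials n s))"
  proof
    fix x assume "x \<in> s ` {1..n}"
    then have "x \<in> cuntz_monomials n s"
      using cuntz_monomials_memI[of "[_]" "[]" 1] by auto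
    then show "x \<in> closure (span (cuntz_monomials n s))"
      using closure_subset span_base by blast
  qed
  ultimately show ?thesis
    using hull_minimal[of "s ` {1..n}" _ cstar_subalgebra] assms by blast
qed

section \<open>Sub-Cuntz states\<close>

text \<open>
  The values at all words of length \<open>m\<close> are encoded in the single equation \<open>\<omega>(s(z)) = 1\<close>: it forces
  the isometry \<open>s(z)\<close> to be absorbed by \<open>\<omega>\<close>, and \<open>s\<^sub>J\<^sup>* s(z) = z\<^sub>J\<close>.
\<close>

lemma sub_cuntz_state_iff:
  assumes "z \<in> unit_vectors n m"
  shows "sub_cuntz_state n m s z \<omega> \<longleftrightarrow> state \<omega> \<and> \<omega> (creation n s m z) = 1"
proof (intro iffI conjI)
  assume sub: "sub_cuntz_state n m s z \<omega>"
  then show st: "state \<omega>" by (simp add: sub_cuntz_state_def)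
  have "\<omega> (creation n s m z) = (\<Sum>J\<in>words n m. z J * cnj (z J))"
    using sub by (simp add: creation_def state_sum[OF st] state_scaleC[OF st] sub_cuntz_state_def)
  then show "\<omega> (creation n s m z) = 1" by (simp add: unit_vector_inner_self[OF assms])
next
  assume "state \<omega> \<and> \<omega> (creation n s m z) = 1"
  then have st: "state \<omega>" and one: "\<omega> (creation n s m z) = 1" by auto
  have "\<omega> (word_prod s J) = cnj (z J)" if "J \<in> words n m" for J
  proof -
    have "\<omega> (star (word_prod s J)) = \<omega> (star (word_prod s J) * creation n s m z)"
      by (rule state_fixed_isometry[OF st creation_isometry[OF assms] one, symmetric])
    also have "\<dots> = z J"
      by (simp add: star_word_mult_creation that state_scaleC[OF st] state_one[OF st])
    finally have "cnj (cnj (\<omega> (word_prod s J))) = cnj (z J)"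
      by (simp only: state_star[OF st])
    then show ?thesis by simp
  qed
  with st show "sub_cuntz_state n m s z \<omega>" by (simp add: sub_cuntz_state_def)
qed

context
  fixes m :: nat and z :: "nat list \<Rightarrow> complex" and \<omega> :: "'a \<Rightarrow> complex"
  assumes m: "1 \<le> m" and z: "z \<in> unit_vectors n m" and sub: "sub_cuntz_state n m s z \<omega>"
begin

lemma sub_cuntz_state_is_state: "state \<omega>"
  using sub by (simp add: sub_cuntz_state_def)

lemma sub_cuntz_absorb: "\<omega> (x * creation n s m z) = \<omega> x"
  using sub state_fixed_isometry[OF sub_cuntz_state_is_state creation_isometry[OF z]]
  unfolding sub_cuntz_state_iff[OF z] by blast

lemma sub_cuntz_star_word:
  assumes "J \<in> words n m"
  shows "\<omega> (x * star (word_prod s J)) = z J * \<omega> x"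
proof -
  have "\<omega> (x * star (word_prod s J)) = \<omega> (x * (star (word_prod s J) * creation n s m z))"
    using sub_cuntz_absorb[of "x * star (word_prod s J)"] by (simp add: mult.assoc)
  then show ?thesis
    by (simp add: star_word_mult_creation assms mult_scaleC_right state_scaleC sub_cuntz_state_is_state)
qed

lemma word_coeff_append:
  "length J = m \<Longrightarrow> word_coeff m z (J @ K) = z J * word_coeff m z K"
  using m unfolding word_coeff_def
  by (simp add: prod.lessThan_Suc_shift del: prod.lessThan_Suc)

lemma word_coeff_single: "length J = m \<Longrightarrow> word_coeff m z J = z J"
  using word_coeff_append[of J "[]"] by (simp add: word_coeff_def)

text \<open>
  As \<open>s\<^sub>J\<^sub>K\<^sup>* = s\<^sub>K\<^sup>* s\<^sub>J\<^sup>*\<close>, the first block of a word is the rightmost factor of its adjoint, so blocks are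
  split off from the front.
\<close>

lemma sub_cuntz_star_words:
  assumes "K \<in> words n (m * q)"
  shows "\<omega> (x * star (word_prod s K)) = word_coeff m z K * \<omega> x"
  using assms
proof (induction q arbitrary: K x)
  case 0
  then show ?case by (simp add: words_0 word_coeff_def)
next
  case (Suc q)
  let ?J = "take m K" and ?K = "drop m K"
  have J: "?J \<in> words n m" and K: "?K \<in> words n (m * q)"
    using Suc.prems take_in_words[of K n m "m * q"] drop_in_words[of K n m "m * q"] by simp_all
  have "\<omega> (x * star (word_prod s (?J @ ?K)))
      = \<omega> (x * star (word_prod s ?K) * star (word_prod s ?J))"
    by (simp add: word_prod_append star_mult mult.assoc del: append_take_drop_id)
  also have "\<dots> = word_coeff m z (?J @ ?K) * \<omega> x"
    by (simp add: sub_cuntz_star_word[OF J] Suc.IH[OF K] word_coeff_append[OF length_words[OF J]]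
        del: append_take_drop_id)
  finally show ?case by simp
qed

lemma sub_cuntz_words:
  assumes "J \<in> words n (m * q)"
  shows "\<omega> (word_prod s J * x) = cnj (word_coeff m z J) * \<omega> x"
proof -
  have "cnj (\<omega> (word_prod s J * x)) = \<omega> (star x * star (word_prod s J))"
    by (simp only: state_star[OF sub_cuntz_state_is_state, symmetric] star_mult)
  also have "\<dots> = cnj (cnj (word_coeff m z J) * \<omega> x)"
    by (simp add: sub_cuntz_star_words[OF assms] state_star[OF sub_cuntz_state_is_state])
  finally show ?thesis by (simp only: complex_cnj_cancel_iff)
qed

lemma sub_cuntz_aligned:
  assumes "J \<in> words n (m * p)" and "K \<in> words n (m * q)"
  shows "\<omega> (word_prod s J * star (word_prod s K)) = cnj (word_coeff m z J) * word_coeff m z K"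
  by (simp add: sub_cuntz_words[OF assms(1)]
      sub_cuntz_star_words[OF assms(2), of 1, simplified] state_one[OF sub_cuntz_state_is_state])

text \<open>
  After the aligned parts are split off, \<open>J\<^sub>2\<close> and \<open>K\<^sub>2\<close> are both lengthened to one full block.
\<close>

lemma sub_cuntz_equally_shifted:
  assumes J: "J1 \<in> words n (m * p)" "J2 \<in> words n r" and K: "K1 \<in> words n (m * q)" "K2 \<in> words n r"
    and r: "r \<le> m"
  shows "\<omega> (word_prod s (J1 @ J2) * star (word_prod s (K1 @ K2))) =
    cnj (word_coeff m z J1) * word_coeff m z K1 *
      (\<Sum>L\<in>words n (m - r). cnj (z (J2 @ L)) * z (K2 @ L))"
proof -
  have len: "X @ L \<in> words n m" if "X \<in> words n r" "L \<in> words n (m - r)" for X L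
    using append_in_words[OF that] r by simp
  have "\<omega> (word_prod s (J1 @ J2) * star (word_prod s (K1 @ K2))) =
      \<omega> (word_prod s J1 * (word_prod s J2 * star (word_prod s K2)) * star (word_prod s K1))"
    by (simp add: word_prod_append star_mult mult.assoc)
  also have "\<dots> = cnj (word_coeff m z J1) * word_coeff m z K1 *
      \<omega> (word_prod s J2 * star (word_prod s K2))"
    by (simp add: sub_cuntz_star_words[OF K(1)] sub_cuntz_words[OF J(1)])
  also have "\<omega> (word_prod s J2 * star (word_prod s K2))
      = (\<Sum>L\<in>words n (m - r). \<omega> (word_prod s (J2 @ L) * star (word_prod s (K2 @ L))))"
    by (subst word_expand[of J2 K2 "m - r"]) (rule state_sum[OF sub_cuntz_state_is_state])
  also have "\<dots> = (\<Sum>L\<in>words n (m - r). cnj (z (J2 @ L)) * z (K2 @ L))"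
  proof (rule sum.cong[OF refl])
    fix L assume L: "L \<in> words n (m - r)"
    show "\<omega> (word_prod s (J2 @ L) * star (word_prod s (K2 @ L))) = cnj (z (J2 @ L)) * z (K2 @ L)"
      using sub_cuntz_aligned[of "J2 @ L" 1 "K2 @ L" 1] len[OF J(2) L] len[OF K(2) L]
        word_coeff_single[OF length_words[OF len[OF J(2) L]]]
        word_coeff_single[OF length_words[OF len[OF K(2) L]]]
      by simp
  qed
  finally show ?thesis .
qed

text \<open>
  For \<open>y\<^sub>K = \<omega>(s\<^sub>K\<^sup>*)\<close>, splitting off the first \<open>m\<close> letters gives \<open>\<omega>(s\<^sub>X\<^sup>*) = (z \<otimes> y)\<^sub>X\<close> for
  \<open>|X| = k + m\<close>, while \<open>\<omega>(s\<^sub>K s(z)) = \<omega>(s\<^sub>K)\<close> expresses \<open>y\<^sub>K\<close> through the words \<open>X = KJ\<close> with \<open>|J| = m\<close>.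
  Together they give \<open>z \<otimes> y = y \<otimes> z\<close>, which for nonperiodic \<open>z\<close> excludes \<open>y \<noteq> 0\<close>,
  the degree \<open>k\<close> being positive and below \<open>m\<close>.
\<close>

lemma sub_cuntz_short_word_zero:
  assumes "nonperiodic n z" and "1 \<le> k" "k < m" and K: "K \<in> words n k"
  shows "\<omega> (star (word_prod s K)) = 0"
proof -
  define y where "y K = (if K \<in> words n k then \<omega> (star (word_prod s K)) else 0)" for K
  have y: "y \<in> tensor_space n k" by (simp add: y_def tensor_space_def)
  have zt: "z \<in> tensor_space n m" and "z \<noteq> (\<lambda>J. 0)"
    using z by (auto simp: unit_vectors_def)
  have split: "\<omega> (star (word_prod s X)) = tensor m z y X" if "X \<in> words n (k + m)" for X
  proof -
    have J: "take m X \<in> words n m" and K: "drop m X \<in> words n k"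
      using that take_in_words[of X n m k] drop_in_words[of X n m k] by (simp_all add: add.commute)
    have "\<omega> (star (word_prod s (take m X @ drop m X))) = z (take m X) * y (drop m X)"
      by (simp only: word_prod_append star_mult sub_cuntz_star_word[OF J])
        (simp add: y_def K)
    then show ?thesis by (simp add: tensor_def)
  qed
  have "y K = (\<Sum>J\<in>words n m. cnj (z J) * tensor m z y (K @ J))" if K: "K \<in> words n k" for K
  proof -
    have "cnj (\<omega> (word_prod s K * creation n s m z)) = y K"
      by (simp add: sub_cuntz_absorb y_def K state_star[OF sub_cuntz_state_is_state])
    moreover have "cnj (\<omega> (word_prod s K * creation n s m z))
        = (\<Sum>J\<in>words n m. cnj (z J) * \<omega> (star (word_prod s (K @ J))))"
      by (simp add: creation_def sum_distrib_left mult_scaleC_right word_prod_append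
          state_linear[OF sub_cuntz_state_is_state] state_star[OF sub_cuntz_state_is_state])
    ultimately show ?thesis using split append_in_words[OF K] by simp
  qed
  then have "tensor m z y = tensor k y z"
    by (rule tensor_eq_if_contraction_isometric[OF y z])
  then have "y = (\<lambda>J. 0)"
    using nonperiodic_commuting_degree[OF assms(1) zt \<open>z \<noteq> _\<close> y] assms(2,3) m by force
  then show ?thesis using K y_def by metis
qed

lemma sub_cuntz_unaligned_word_zero:
  assumes "nonperiodic n z" and K: "K \<in> words n k" and k: "\<not> m dvd k"
  shows "\<omega> (star (word_prod s K)) = 0"
proof -
  let ?q = "m * (k div m)"
  have K1: "take ?q K \<in> words n ?q" and K2: "drop ?q K \<in> words n (k mod m)"
    using K take_in_words[of K n ?q "k mod m"] drop_in_words[of K n ?q "k mod m"] by simp_all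
  have "\<omega> (star (word_prod s (take ?q K @ drop ?q K)))
      = word_coeff m z (take ?q K) * \<omega> (star (word_prod s (drop ?q K)))"
    by (simp only: word_prod_append star_mult sub_cuntz_star_words[OF K1])
  moreover have "\<omega> (star (word_prod s (drop ?q K))) = 0"
    using sub_cuntz_short_word_zero[OF assms(1) _ _ K2] k m
    by (simp add: dvd_eq_mod_eq_0)
  ultimately show ?thesis by simp
qed

text \<open>
  Lengthening both words by \<open>(m - 1) a\<close> letters brings \<open>J\<close> to length \<open>m a\<close>, and with it \<open>K\<close> to a
  multiple of \<open>m\<close>. What matters is that the right-hand side depends on \<open>z\<close> alone and not on \<open>\<omega>\<close>.
\<close>

lemma sub_cuntz_congruent:
  assumes J: "J \<in> words n a" and K: "K \<in> words n b" and ab: "int m dvd int a - int b"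
  shows "\<omega> (word_prod s J * star (word_prod s K)) =
    (\<Sum>L\<in>words n ((m - 1) * a). cnj (word_coeff m z (J @ L)) * word_coeff m z (K @ L))"
proof -
  define l where "l = (m - 1) * a"
  have al: "a + l = m * a" using m by (cases m) (simp_all add: l_def)
  have "int m dvd int (m * a) - (int a - int b)"
    by (rule dvd_diff[OF _ ab]) simp
  moreover have "int (m * a) - (int a - int b) = int (b + l)" using al by linarith
  ultimately have "m dvd b + l" by (simp only: int_dvd_int_iff)
  then obtain q where bl: "b + l = m * q" by (elim dvdE)
  have "\<omega> (word_prod s (J @ L) * star (word_prod s (K @ L)))
      = cnj (word_coeff m z (J @ L)) * word_coeff m z (K @ L)" if "L \<in> words n l" for L
    using append_in_words[OF J that] append_in_words[OF K that]
    unfolding al bl by (rule sub_cuntz_aligned)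
  then show ?thesis
    by (subst word_expand[of J K l]) (simp add: state_sum[OF sub_cuntz_state_is_state] l_def)
qed

lemma sub_cuntz_unaligned_zero:
  assumes "nonperiodic n z" and J: "J \<in> words n a" and K: "K \<in> words n b"
    and ab: "\<not> int m dvd int a - int b"
  shows "\<omega> (word_prod s J * star (word_prod s K)) = 0"
proof -
  define l where "l = (m - 1) * a"
  have al: "a + l = m * a" using m by (cases m) (simp_all add: l_def)
  have "\<not> m dvd b + l"
  proof
    assume "m dvd b + l"
    then have "int m dvd int (m * a) - int (b + l)"
      by (metis dvd_diff dvd_triv_left int_dvd_int_iff)
    moreover have "int (m * a) - int (b + l) = int a - int b" using al by linarith
    ultimately show False using ab by (simp only:)
  qed
  then have "\<omega> (word_prod s (J @ L) * star (word_prod s (K @ L))) = 0" if "L \<in> words n l" for L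
    using sub_cuntz_words[of "J @ L" a] append_in_words[OF J that] append_in_words[OF K that]
      sub_cuntz_unaligned_word_zero[OF assms(1)] al by simp
  then show ?thesis
    by (subst word_expand[of J K l]) (simp add: state_sum[OF sub_cuntz_state_is_state])
qed

end

end

section \<open>Uniqueness and purity\<close>

lemma cuntz_algebra_family: "cuntz_algebra n s \<Longrightarrow> cuntz_family type_struct n s"
  by (simp add: cuntz_algebra_def)

lemma sub_cuntz_state_unique:
  fixes s :: "nat \<Rightarrow> 'a::cstar_algebra"
  assumes alg: "cuntz_algebra n s" and m: "1 \<le> m" and z: "z \<in> unit_vectors n m"
    and "nonperiodic n z" and sub: "sub_cuntz_state n m s z \<omega>" "sub_cuntz_state n m s z \<omega>'"
  shows "\<omega> = \<omega>'"
proof (rule states_eq_if_eq_on_total_set)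
  note cuntz = cuntz_algebra_family[OF alg]
  show st: "state \<omega>" "state \<omega>'" using sub by (simp_all add: sub_cuntz_state_def)
  show "closure (span (cuntz_monomials n s)) = UNIV"
    using alg by (intro closure_span_cuntz_monomials cuntz) (simp add: cuntz_algebra_def)
  fix x assume "x \<in> cuntz_monomials n s"
  then obtain c J K where x: "x = scaleC c (word_prod s J * star (word_prod s K))"
    and "J \<in> lists {1..n}" "K \<in> lists {1..n}"
    unfolding cuntz_monomials_def by blast
  then have J: "J \<in> words n (length J)" and K: "K \<in> words n (length K)"
    by (simp_all add: words_def)
  have "\<omega> (word_prod s J * star (word_prod s K)) = \<omega>' (word_prod s J * star (word_prod s K))"
  proof (cases "int m dvd int (length J) - int (length K)")
    case True
    show ?thesis
      by (simp only: sub_cuntz_congruent[OF cuntz m z sub(1) J K True]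
          sub_cuntz_congruent[OF cuntz m z sub(2) J K True])
  next
    case False
    show ?thesis
      by (simp only: sub_cuntz_unaligned_zero[OF cuntz m z sub(1) \<open>nonperiodic n z\<close> J K False]
          sub_cuntz_unaligned_zero[OF cuntz m z sub(2) \<open>nonperiodic n z\<close> J K False])
  qed
  then show "\<omega> x = \<omega>' x" by (simp add: x state_scaleC[OF st(1)] state_scaleC[OF st(2)])
qed

lemma one_extreme_in_unit_disc:
  fixes a b :: complex
  assumes "cmod a \<le> 1" "cmod b \<le> 1" "0 < t" "t < 1"
    and eq: "1 = of_real t * a + of_real (1 - t) * b"
  shows "a = 1 \<and> b = 1"
proof -
  have Re1: "c = 1" if "cmod c \<le> 1" "1 \<le> Re c" for c
  proof -
    have "Re c = 1" using that complex_Re_le_cmod[of c] by simp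
    moreover have "(Re c)\<^sup>2 + (Im c)\<^sup>2 \<le> 1"
      using that(1) by (simp add: norm_complex_def)
    ultimately show ?thesis by (simp add: complex_eq_iff)
  qed
  have "t * Re a + (1 - t) * Re b = 1"
    using arg_cong[OF eq, of Re] by simp
  moreover have ab: "Re a \<le> 1" "Re b \<le> 1"
    using complex_Re_le_cmod[of a] complex_Re_le_cmod[of b] assms(1,2) by linarith+
  ultimately have "t * (1 - Re a) + (1 - t) * (1 - Re b) = 0"
    by (simp add: algebra_simps)
  moreover have "0 \<le> t * (1 - Re a)" "0 \<le> (1 - t) * (1 - Re b)"
    using ab assms(3,4) by simp_all
  ultimately have "t * (1 - Re a) = 0" "(1 - t) * (1 - Re b) = 0" by linarith+
  then have "1 \<le> Re a" "1 \<le> Re b" using assms(3,4) by simp_all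
  then show ?thesis using Re1 assms(1,2) by blast
qed

text \<open>
  Any state takes a value of modulus at most \<open>1\<close> at the isometry \<open>s(z)\<close>, and \<open>1\<close> is an extreme point
  of the unit disc. So the components of a convex decomposition are sub-Cuntz states by \<open>z\<close> themselves.
\<close>

lemma unique_sub_cuntz_state_pure:
  fixes s :: "nat \<Rightarrow> 'a::cstar_algebra"
  assumes cuntz: "cuntz_family type_struct n s" and z: "z \<in> unit_vectors n m"
    and sub: "sub_cuntz_state n m s z \<omega>"
    and unique: "\<And>\<omega>'. sub_cuntz_state n m s z \<omega>' \<Longrightarrow> \<omega>' = \<omega>"
  shows "pure_state \<omega>"
  unfolding pure_state_def
proof (intro conjI allI impI; (elim conjE)?)
  let ?v = "creation n s m z"
  show "state \<omega>" using sub by (simp add: sub_cuntz_state_def)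
  fix \<omega>1 \<omega>2 :: "'a \<Rightarrow> complex" and t :: real
  assume st: "state \<omega>1" "state \<omega>2" and t: "0 < t" "t < 1"
    and convex: "\<forall>x. \<omega> x = of_real t * \<omega>1 x + of_real (1 - t) * \<omega>2 x"
  have "cmod (\<omega>' ?v) \<le> 1" if "state \<omega>'" for \<omega>'
  proof (rule power2_le_imp_le)
    show "(cmod (\<omega>' ?v))\<^sup>2 \<le> 1\<^sup>2"
      using state_norm_square_le[OF that, of ?v]
      by (simp add: creation_isometry[OF cuntz z] state_one[OF that])
  qed simp
  moreover have "1 = of_real t * \<omega>1 ?v + of_real (1 - t) * \<omega>2 ?v"
    using sub sub_cuntz_state_iff[OF cuntz z, of \<omega>] convex by metis
  ultimately have "\<omega>1 ?v = 1 \<and> \<omega>2 ?v = 1"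
    using one_extreme_in_unit_disc t st by blast
  then show "\<omega>1 = \<omega>" "\<omega>2 = \<omega>"
    using st sub_cuntz_state_iff[OF cuntz z] by (auto intro: unique)
qed

section \<open>Gauge automorphisms and periodic vectors\<close>

lemma star_homD:
  assumes "star_hom type_struct \<gamma>"
  shows "\<gamma> (x + y) = \<gamma> x + \<gamma> y" "\<gamma> (scaleC c x) = scaleC c (\<gamma> x)" "\<gamma> (x * y) = \<gamma> x * \<gamma> y"
    "\<gamma> (star x) = star (\<gamma> x)" "\<gamma> 1 = 1"
  using assms by (simp_all add: star_hom_def)

lemma star_hom_sum:
  assumes "star_hom type_struct \<gamma>"
  shows "\<gamma> (\<Sum>i\<in>I. f i) = (\<Sum>i\<in>I. \<gamma> (f i))"
proof -
  have "\<gamma> 0 = 0" using star_homD(2)[OF assms, of 0 0] by simp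
  then show ?thesis
    by (induction I rule: infinite_finite_induct) (simp_all add: star_homD[OF assms])
qed

lemma state_star_hom:
  assumes "state \<omega>" and "star_hom type_struct \<gamma>"
  shows "state (\<lambda>x. \<omega> (\<gamma> x))"
  using assms(1) by (simp add: state_def star_homD[OF assms(2)])

text \<open>
  The rescaled generators \<open>c s\<^sub>i\<close> satisfy the Cuntz relations again, so the universal property applies
  with the algebra itself as target.
\<close>

lemma gauge_endomorphism:
  fixes s :: "nat \<Rightarrow> 'a::cstar_algebra"
  assumes alg: "cuntz_algebra n s" and "cmod c = 1"
  obtains \<gamma> :: "'a \<Rightarrow> 'a" where "star_hom type_struct \<gamma>"
    "\<And>k x. \<gamma> (creation n s k x) = scaleC (c ^ k) (creation n s k x)"
proof -
  have c: "cnj c * c = 1" "c * cnj c = 1"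
    using complex_norm_square[of c] assms(2) by (simp_all add: mult.commute)
  have "cuntz_family type_struct n s" by (rule cuntz_algebra_family[OF alg])
  then have "cuntz_family type_struct n (\<lambda>i. scaleC c (s i))"
    unfolding cuntz_family_type_struct
    by (simp add: star_scaleC mult_scaleC_left mult_scaleC_right scaleC_scaleC c)
  then obtain \<gamma> :: "'a \<Rightarrow> 'a" where hom: "star_hom type_struct \<gamma>"
    and gen: "\<forall>i\<in>{1..n}. \<gamma> (s i) = scaleC c (s i)"
    using alg cstar_structure_type_struct unfolding cuntz_algebra_def by blast
  have word: "\<gamma> (word_prod s J) = scaleC (c ^ length J) (word_prod s J)" if "J \<in> lists {1..n}" for J
    using that
    by (induction J rule: list.induct)
      (simp_all add: star_homD[OF hom] gen mult_scaleC_left mult_scaleC_right scaleC_scaleC mult.commute)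
  have "\<gamma> (creation n s k x) = scaleC (c ^ k) (creation n s k x)" for k x
    unfolding creation_def star_hom_sum[OF hom] scaleC_sum_right
    by (rule sum.cong) (simp_all add: words_def star_homD[OF hom] word scaleC_scaleC mult.commute)
  with hom show ?thesis by (rule that)
qed

text \<open>
  Let \<open>c\<close> be a primitive \<open>m\<close>-th root of unity. The gauge transformation by \<open>c\<close> fixes \<open>s(z)\<close>, so it
  maps sub-Cuntz states by \<open>z\<close> to such states; the unique one is invariant, although
  \<open>s(y)\<close> is multiplied by \<open>c\<^sup>j \<noteq> 1\<close>.
\<close>

lemma unique_sub_cuntz_state_creation_zero:
  assumes alg: "cuntz_algebra n s" and m: "1 \<le> m" and z: "z \<in> unit_vectors n m"
    and sub: "sub_cuntz_state n m s z \<omega>"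
    and unique: "\<And>\<omega>'. sub_cuntz_state n m s z \<omega>' \<Longrightarrow> \<omega>' = \<omega>"
    and "\<not> m dvd j"
  shows "\<omega> (creation n s j y) = 0"
proof -
  define c where "c = exp (2 * of_real pi * \<i> * of_nat 1 / of_nat m)"
  have cm: "c ^ m = 1" unfolding c_def using m by (intro complex_root_unity) simp
  have cj: "c ^ j \<noteq> 1"
  proof -
    have "c ^ j = exp (2 * of_real pi * \<i> * of_nat j / of_nat m)"
      unfolding c_def exp_of_nat_mult[symmetric] by (simp add: field_simps)
    then show ?thesis
      using complex_root_unity_eq_1[of m j] m \<open>\<not> m dvd j\<close> by simp
  qed
  have "cmod c = 1" by (simp add: c_def)
  then obtain \<gamma> where hom: "star_hom type_struct \<gamma>"
    and \<gamma>: "\<And>k x. \<gamma> (creation n s k x) = scaleC (c ^ k) (creation n s k x)"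
    using gauge_endomorphism[OF alg] by blast
  note iff = sub_cuntz_state_iff[OF cuntz_algebra_family[OF alg] z]
  have st: "state \<omega>" and one: "\<omega> (creation n s m z) = 1" using sub iff by auto
  have "sub_cuntz_state n m s z (\<lambda>x. \<omega> (\<gamma> x))"
    unfolding iff by (simp add: state_star_hom[OF st hom] \<gamma> cm one)
  then have "(\<lambda>x. \<omega> (\<gamma> x)) = \<omega>" by (rule unique)
  then have "\<omega> (\<gamma> (creation n s j y)) = \<omega> (creation n s j y)" by metis
  then have "c ^ j * \<omega> (creation n s j y) = \<omega> (creation n s j y)"
    by (simp add: \<gamma> state_scaleC[OF st])
  then show ?thesis using cj by simp
qed

text \<open>
  This is the vector state of \<open>T\<Omega>\<close> after normalisation, where \<open>\<Omega>\<close> is the GNS vector of \<open>\<omega>\<close>.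
\<close>

lemma state_compress:
  assumes st: "state \<omega>" and T: "\<omega> (star T * T) = of_real r" and r: "0 < r"
  shows "state (\<lambda>x. \<omega> (star T * x * T) / of_real r)"
  unfolding state_def
proof (intro conjI allI)
  fix x y c
  show "\<omega> (star T * (x + y) * T) / of_real r = \<omega> (star T * x * T) / of_real r + \<omega> (star T * y * T) / of_real r"
    by (simp add: algebra_simps state_add[OF st] add_divide_distrib)
  show "\<omega> (star T * scaleC c x * T) / of_real r = c * (\<omega> (star T * x * T) / of_real r)"
    by (simp add: mult_scaleC_left mult_scaleC_right state_scaleC[OF st])
  have "star T * (star x * x) * T = star (x * T) * (x * T)"
    by (simp add: star_mult mult.assoc)
  then show "\<omega> (star T * (star x * x) * T) / of_real r \<in> \<real>\<^sub>\<ge>\<^sub>0"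
    using state_positive[OF st, of "x * T"] r by (simp add: nonneg_Reals_divide_I)
  show "\<omega> (star T * 1 * T) / of_real r = 1" using T r by simp
qed

lemma isometry_power:
  assumes "star A * A = (1 :: 'a::cstar_algebra)" and "i \<le> j"
  shows "star (A ^ i) * A ^ j = A ^ (j - i)"
  using assms(2)
proof (induction i arbitrary: j)
  case (Suc i)
  then obtain j' where j: "j = Suc j'" by (cases j) auto
  have "star (A ^ Suc i) * A ^ j = star (A ^ i) * (star A * A) * A ^ j'"
    by (simp add: j star_mult mult.assoc)
  then show ?case using Suc by (simp add: j assms(1))
qed simp

text \<open>
  If \<open>z = x\<^sup>\<otimes>\<^sup>p\<close> with \<open>p > 1\<close>, then \<open>A = s(x)\<close> satisfies \<open>A\<^sup>p = s(z)\<close>, and the unique state \<open>\<omega>\<close>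
  vanishes on \<open>A, \<dots>, A\<^sup>p\<^sup>-\<^sup>1\<close>. With \<open>T = 1 + A + \<dots> + A\<^sup>p\<^sup>-\<^sup>1\<close>, the vector \<open>T\<Omega>\<close> has squared norm
  \<open>p\<close> and is fixed by \<open>A\<close>, so its normalised vector state is a second sub-Cuntz state by \<open>z\<close>.
\<close>

lemma unique_sub_cuntz_state_nonperiodic:
  fixes s :: "nat \<Rightarrow> 'a::cstar_algebra"
  assumes alg: "cuntz_algebra n s" and m: "1 \<le> m" and z: "z \<in> unit_vectors n m"
    and sub: "sub_cuntz_state n m s z \<omega>"
    and unique: "\<And>\<omega>'. sub_cuntz_state n m s z \<omega>' \<Longrightarrow> \<omega>' = \<omega>"
  shows "nonperiodic n z"
  unfolding nonperiodic_def
proof (intro allI ballI impI)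
  fix p k x
  assume p: "1 \<le> p" and k: "1 \<le> k" and x: "x \<in> tensor_space n k" and zx: "z = tensor_power k x p"
  note cuntz = cuntz_algebra_family[OF alg]
  note iff = sub_cuntz_state_iff[OF cuntz z]
  \<comment> \<open>A nonzero tensor has only one degree.\<close>
  have mk: "m = k * p"
  proof -
    obtain J where "z J \<noteq> 0"
    proof -
      have "z \<noteq> (\<lambda>J. 0)" using z by (auto simp: unit_vectors_def)
      then show ?thesis using that by auto
    qed
    then have "J \<in> words n m" "J \<in> words n (p * k)"
      using z tensor_power_in_tensor_space[OF x, of p] zx
      by (auto simp: unit_vectors_def tensor_space_def)
    then show ?thesis by (simp add: words_def)
  qed
  have "(\<Sum>J\<in>words n k. (cmod (x J))\<^sup>2) ^ p = 1 ^ p"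
    using z sum_cmod_square_tensor_power[of k x p n] by (simp add: unit_vectors_def zx mk)
  then have "(\<Sum>J\<in>words n k. (cmod (x J))\<^sup>2) = 1"
    using p by (subst (asm) power_eq_iff_eq_base) (auto intro: sum_nonneg)
  with x have xu: "x \<in> unit_vectors n k" by (simp add: unit_vectors_def)
  define A where "A = creation n s k x"
  have iso: "star A * A = 1" unfolding A_def by (rule creation_isometry[OF cuntz xu])
  have Ap: "creation n s m z = A ^ p"
    by (simp add: A_def zx mk creation_tensor_power)
  have st: "state \<omega>" using sub by (simp add: sub_cuntz_state_def)
  have zero: "\<omega> (A ^ i) = 0" if "0 < i" "i < p" for i
  proof -
    have "\<not> m dvd k * i" using that k mk by (auto dest: dvd_imp_le)
    then show ?thesis
      unfolding A_def creation_tensor_power[symmetric]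
      by (intro unique_sub_cuntz_state_creation_zero[OF alg m z sub unique])
  qed
  show "p = 1"
  proof (rule ccontr)
    assume "p \<noteq> 1"
    with p have p1: "1 < p" by simp
    define T where "T = (\<Sum>i<p. A ^ i)"
    have orthonormal: "\<omega> (star (A ^ i) * A ^ j) = (if i = j then 1 else 0)" if "i < p" "j < p" for i j
    proof -
      have le: "\<omega> (star (A ^ i) * A ^ j) = (if i = j then 1 else 0)" if "i \<le> j" "j < p" for i j
        using that zero[of "j - i"] by (auto simp: isometry_power[OF iso] state_one[OF st])
      show ?thesis
      proof (cases "i \<le> j")
        case True
        then show ?thesis using le that by blast
      next
        case False
        then have "cnj (\<omega> (star (A ^ j) * A ^ i)) = 0" using le[of j i] that by simp
        then have "\<omega> (star (star (A ^ j) * A ^ i)) = 0" by (simp only: state_star[OF st])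
        then show ?thesis using False by (simp add: star_mult star_star)
      qed
    qed
    have "\<omega> (star T * T) = (\<Sum>i<p. \<Sum>j<p. \<omega> (star (A ^ i) * A ^ j))"
      unfolding T_def star_sum sum_product state_sum[OF st] ..
    also have "\<dots> = (\<Sum>i<p. \<Sum>j<p. if i = j then 1 else 0)"
      by (intro sum.cong refl orthonormal) auto
    also have "\<dots> = of_real (real p)" by simp
    finally have TT: "\<omega> (star T * T) = of_real (real p)" .
    \<comment> \<open>Up to replacing \<open>1\<close> by \<open>A\<^sup>p\<close>, multiplication by \<open>A\<close> permutes the summands of \<open>T\<close>;
      \<open>\<omega>\<close> does not see the difference.\<close>
    have AT: "A * T = T - 1 + A ^ p"
    proof -
      have "1 + A * T = (\<Sum>i<Suc p. A ^ i)"
        unfolding sum.lessThan_Suc_shift by (simp add: T_def sum_distrib_left)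
      then show ?thesis by (simp add: T_def algebra_simps)
    qed
    define \<omega>' where "\<omega>' x = \<omega> (star T * x * T) / of_real (real p)" for x
    have st': "state \<omega>'"
      unfolding \<omega>'_def using state_compress[OF st TT] p by simp
    have "\<omega> (star T * A * T) = \<omega> (star T * T) - \<omega> (star T) + \<omega> (star T * A ^ p)"
      by (simp add: mult.assoc AT right_diff_distrib distrib_left state_linear[OF st])
    also have "\<omega> (star T * A ^ p) = \<omega> (star T)"
      using sub_cuntz_absorb[OF cuntz m z sub, of "star T"] by (simp add: Ap)
    finally have A1: "\<omega>' A = 1" using p by (simp add: \<omega>'_def TT)
    have "\<omega>' (A ^ i) = 1" for i
    proof (induction i)
      case (Suc i)
      then show ?case
        using state_fixed_isometry[OF st' iso A1, of "A ^ i"] by (simp add: power_commutes)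
    qed (simp add: state_one[OF st'])
    then have "\<omega>' = \<omega>" using unique[of \<omega>'] st' by (simp add: iff Ap)
    then show False using A1 zero[of 1] p1 by simp
  qed
qed

theorem theorem1p4:
  fixes n m :: nat
    and s :: "nat \<Rightarrow> 'a::cstar_algebra"
    and z :: "nat list \<Rightarrow> complex"
    and \<omega> :: "'a \<Rightarrow> complex"
  assumes "2 \<le> n" and "1 \<le> m"
    and "cuntz_algebra n s"
    and "z \<in> unit_vectors n m"
    and "sub_cuntz_state n m s z \<omega>"
  shows "((\<forall>\<omega>'. sub_cuntz_state n m s z \<omega>' \<longrightarrow> \<omega>' = \<omega>) \<longleftrightarrow> nonperiodic n z) \<and>
    (nonperiodic n z \<longrightarrow> pure_state \<omega>) \<and>
    (nonperiodic n z \<longrightarrow>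
      (\<forall>J\<in>lists {1..n}. \<forall>K\<in>lists {1..n}.
        (m dvd length J \<and> m dvd length K \<longrightarrow>
           \<omega> (word_prod s J * star (word_prod s K)) = cnj (word_coeff m z J) * word_coeff m z K) \<and>
        (\<not> int m dvd int (length J) - int (length K) \<longrightarrow>
           \<omega> (word_prod s J * star (word_prod s K)) = 0) \<and>
        (\<forall>J1 J2 K1 K2.
           J = J1 @ J2 \<and> K = K1 @ K2 \<and> m dvd length J1 \<and> m dvd length K1 \<and>
           1 \<le> length J2 \<and> length J2 = length K2 \<and> length J2 \<le> m - 1 \<longrightarrow>
           \<omega> (word_prod s J * star (word_prod s K)) =
             cnj (word_coeff m z J1) * word_coeff m z K1 *
             (\<Sum>L\<in>words n (m - length J2). cnj (z (J2 @ L)) * z (K2 @ L)))))"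
proof -
  note m = assms(2) and alg = assms(3) and z = assms(4) and sub = assms(5)
  note cuntz = cuntz_algebra_family[OF alg]
  have unique: "\<omega>' = \<omega>" if "nonperiodic n z" "sub_cuntz_state n m s z \<omega>'" for \<omega>'
    using sub_cuntz_state_unique[OF alg m z that(1,2) sub] .
  have uniqueness: "(\<forall>\<omega>'. sub_cuntz_state n m s z \<omega>' \<longrightarrow> \<omega>' = \<omega>) \<longleftrightarrow> nonperiodic n z"
    using unique unique_sub_cuntz_state_nonperiodic[OF alg m z sub] by blast
  have pure: "nonperiodic n z \<longrightarrow> pure_state \<omega>"
    using unique unique_sub_cuntz_state_pure[OF cuntz z sub] by blast
  have words: "X \<in> words n (length X)" if "X \<in> lists {1..n}" for X
    using that by (simp add: words_def)
  have aligned: "\<omega> (word_prod s J * star (word_prod s K)) = cnj (word_coeff m z J) * word_coeff m z K"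
    if "J \<in> lists {1..n}" "K \<in> lists {1..n}" "m dvd length J" "m dvd length K" for J K
    using that words[OF that(1)] words[OF that(2)]
    by (auto elim!: dvdE intro!: sub_cuntz_aligned[OF cuntz m z sub])
  have shifted: "\<omega> (word_prod s (J1 @ J2) * star (word_prod s (K1 @ K2))) =
      cnj (word_coeff m z J1) * word_coeff m z K1 *
      (\<Sum>L\<in>words n (m - length J2). cnj (z (J2 @ L)) * z (K2 @ L))"
    if JK: "J1 @ J2 \<in> lists {1..n}" "K1 @ K2 \<in> lists {1..n}"
      and dvd: "m dvd length J1" "m dvd length K1" and r: "length J2 = length K2" "length J2 \<le> m - 1"
    for J1 J2 K1 K2
  proof -
    obtain p q where "length J1 = m * p" "length K1 = m * q" using dvd by (auto elim!: dvdE)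
    then show ?thesis
      using JK words[of J1] words[of J2] words[of K1] words[of K2] r
      by (intro sub_cuntz_equally_shifted[OF cuntz m z sub]) auto
  qed
  have unaligned: "\<omega> (word_prod s J * star (word_prod s K)) = 0"
    if "nonperiodic n z" "J \<in> lists {1..n}" "K \<in> lists {1..n}"
      "\<not> int m dvd int (length J) - int (length K)" for J K
    using sub_cuntz_unaligned_zero[OF cuntz m z sub that(1) words[OF that(2)] words[OF that(3)] that(4)] .
  show ?thesis
    using uniqueness pure aligned shifted unaligned by blast
qed

end
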